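(* Let $1\to R\to F\xrightarrow{\pi}G\to1$ be a free presentation of a perfect multiplicative Lie algebra $G$. Then ${}^M[F,F]/{}^M[R,F]$ is a cover of $G$.
   Context: A multiplicative Lie algebra is a triple $(G,\cdot,\star)$ where $(G,\cdot)$ is a group (not necessarily abelian) and $\star$ is a binary operation on $G$ such that for all $x,y,z\in G$, writing ${}^xy=xyx^{-1}$: (1) $x\star x=1$; (2) $x\star(yz)=(x\star y)\,{}^y(x\star z)$; (3) $(xy)\star z={}^x(y\star z)\,(x\star z)$; (4) $((x\star y)\star{}^yz)((y\star z)\star{}^zx)((z\star x)\star{}^xy)=1$; (5) ${}^z(x\star y)={}^zx\star{}^zy$. An ideal is a normal subgroup $H$ with $x\star y\in H$ for all $x\in G$, $y\in H$; quotients by ideals are multiplicative Lie algebras. Homomorphisms are group homomorphisms preserving $\star$. For ideals $A,B$ of a multiplicative Lie algebra, at least one of which is the whole algebra, ${}^M[A,B]=(A\star B)[A,B]$, where $A\star B$ (resp. $[A,B]$) is the subgroup generated by all $a\star b$ (resp. $[a,b]=aba^{-1}b^{-1}$), $a\in A$, $b\in B$; it is an ideal. $G$ is perfect if ${}^M[G,G]=G$. $Z(G)$ is the group center, $LZ(G)=\{x\in G: x\star y=1\ \forall y\in G\}$, $\mathcal{Z}(G)=LZ(G)\cap Z(G)$. A free presentation of $G$ is a short exact sequence of multiplicative Lie algebras $1\to R\to F\to G\to1$ with $F$ a free multiplicative Lie algebra (free object on a set). The Schur multiplier of $G$ is $\tilde M(G)=({}^M[F,F]\cap R)/{}^M[R,F]$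 for any free presentation of $G$ (independent of the presentation up to isomorphism). A central extension $1\to N\to G^*\to G\to1$ is a short exact sequence of multiplicative Lie algebras with $N\subseteq\mathcal{Z}(G^* )$. It is a stem extension if $N\subseteq{}^M[G^*,G^*]$, and a stem cover if in addition $N\cong\tilde M(G)$; in that case $G^*$ is called a cover of $G$. *)

theory Defs
  imports "HOL-Algebra.Generated_Groups"
begin

section \<open>Multiplicative Lie algebras\<close>

record 'a mult_lie = "'a monoid" +
  lie :: "['a, 'a] \<Rightarrow> 'a" (infixl \<open>\<star>\<index>\<close> 70)

definition conj_by :: "('a, 'm) monoid_scheme \<Rightarrow> 'a \<Rightarrow> 'a \<Rightarrow> 'a"
  where "conj_by G x y = x \<otimes>\<^bsub>G\<^esub> y \<otimes>\<^bsub>G\<^esub> inv\<^bsub>G\<^esub> x"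

locale mult_lie_algebra = group G for G (structure) +
  assumes lie_closed: "\<lbrakk>x \<in> carrier G; y \<in> carrier G\<rbrakk> \<Longrightarrow> x \<star> y \<in> carrier G"
    and lie_self: "x \<in> carrier G \<Longrightarrow> x \<star> x = \<one>"
    and lie_mult_right: "\<lbrakk>x \<in> carrier G; y \<in> carrier G; z \<in> carrier G\<rbrakk>
      \<Longrightarrow> x \<star> (y \<otimes> z) = (x \<star> y) \<otimes> conj_by G y (x \<star> z)"
    and lie_mult_left: "\<lbrakk>x \<in> carrier G; y \<in> carrier G; z \<in> carrier G\<rbrakk>
      \<Longrightarrow> (x \<otimes> y) \<star> z = conj_by G x (y \<star> z) \<otimes> (x \<star> z)"
    and lie_jacobi: "\<lbrakk>x \<in> carrier G; y \<in> carrier G; z \<in> carrier G\<rbrakk>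
      \<Longrightarrow> ((x \<star> y) \<star> conj_by G y z) \<otimes> ((y \<star> z) \<star> conj_by G z x)
            \<otimes> ((z \<star> x) \<star> conj_by G x y) = \<one>"
    and lie_conj: "\<lbrakk>x \<in> carrier G; y \<in> carrier G; z \<in> carrier G\<rbrakk>
      \<Longrightarrow> conj_by G z (x \<star> y) = conj_by G z x \<star> conj_by G z y"

definition mla_hom :: "'a mult_lie \<Rightarrow> 'b mult_lie \<Rightarrow> ('a \<Rightarrow> 'b) set"
  where "mla_hom G H = {h \<in> hom G H.
    \<forall>x\<in>carrier G. \<forall>y\<in>carrier G. h (x \<star>\<^bsub>G\<^esub> y) = h x \<star>\<^bsub>H\<^esub> h y}"

definition mla_isomorphic :: "'a mult_lie \<Rightarrow> 'b mult_lie \<Rightarrow> bool"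
  where "mla_isomorphic G H \<longleftrightarrow> (\<exists>h\<in>mla_hom G H. bij_betw h (carrier G) (carrier H))"

text \<open>The quotient by an ideal \<open>H\<close>: the group is \<^const>\<open>FactGroup\<close>, and the operation on
  cosets is induced from representatives, in the style of \<open>rcoset_mult\<close> for ring ideals.\<close>

definition mla_quotient :: "'a mult_lie \<Rightarrow> 'a set \<Rightarrow> 'a set mult_lie"
  where "mla_quotient G H = \<lparr>carrier = rcosets\<^bsub>G\<^esub> H, mult = set_mult G, one = H,
    lie = (\<lambda>A B. \<Union>a\<in>A. \<Union>b\<in>B. H #>\<^bsub>G\<^esub> (a \<star>\<^bsub>G\<^esub> b))\<rparr>"

definition lie_subgroup :: "'a mult_lie \<Rightarrow> 'a set \<Rightarrow> 'a set \<Rightarrow> 'a set"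
  where "lie_subgroup G A B = generate G {a \<star>\<^bsub>G\<^esub> b | a b. a \<in> A \<and> b \<in> B}"

definition commutator_subgroup :: "'a mult_lie \<Rightarrow> 'a set \<Rightarrow> 'a set \<Rightarrow> 'a set"
  where "commutator_subgroup G A B =
    generate G {a \<otimes>\<^bsub>G\<^esub> b \<otimes>\<^bsub>G\<^esub> inv\<^bsub>G\<^esub> a \<otimes>\<^bsub>G\<^esub> inv\<^bsub>G\<^esub> b | a b. a \<in> A \<and> b \<in> B}"

text \<open>\<open>M_bracket G A B\<close> is the ideal written \<open>\<^sup>M[A, B]\<close> in the literature.\<close>

definition M_bracket :: "'a mult_lie \<Rightarrow> 'a set \<Rightarrow> 'a set \<Rightarrow> 'a set"
  where "M_bracket G A B = lie_subgroup G A B <#>\<^bsub>G\<^esub> commutator_subgroup G A B"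

definition mla_perfect :: "'a mult_lie \<Rightarrow> bool"
  where "mla_perfect G \<longleftrightarrow> M_bracket G (carrier G) (carrier G) = carrier G"

definition group_center :: "'a mult_lie \<Rightarrow> 'a set"
  where "group_center G = {x \<in> carrier G. \<forall>y\<in>carrier G. x \<otimes>\<^bsub>G\<^esub> y = y \<otimes>\<^bsub>G\<^esub> x}"

definition lie_center :: "'a mult_lie \<Rightarrow> 'a set"
  where "lie_center G = {x \<in> carrier G. \<forall>y\<in>carrier G. x \<star>\<^bsub>G\<^esub> y = \<one>\<^bsub>G\<^esub>}"

definition mla_center :: "'a mult_lie \<Rightarrow> 'a set"
  where "mla_center G = lie_center G \<inter> group_center G"

text \<open>In a short exact sequence \<open>1 \<rightarrow> N \<rightarrow> K \<rightarrow> G \<rightarrow> 1\<close> the left-hand term is identified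
  with its image in \<open>K\<close>, that is, with the kernel of \<open>p\<close>.\<close>

definition short_exact :: "'a set \<Rightarrow> 'a mult_lie \<Rightarrow> ('a \<Rightarrow> 'b) \<Rightarrow> 'b mult_lie \<Rightarrow> bool"
  where "short_exact N K p G \<longleftrightarrow>
    mult_lie_algebra K \<and> mult_lie_algebra G \<and> p \<in> mla_hom K G \<and>
    p ` carrier K = carrier G \<and> N = kernel K G p"

section \<open>Free multiplicative Lie algebras\<close>

text \<open>The free multiplicative Lie algebra on \<open>X\<close> is realised by terms with variables in \<open>X\<close>,
  modulo the least congruence containing the defining identities.\<close>

datatype (vars: 'a) mla_term =
    Var 'a
  | One
  | Inv "'a mla_term"
  | Mul "'a mla_term" "'a mla_term"
  | Lie "'a mla_term" "'a mla_term"

abbreviation (input) Conj :: "'a mla_term \<Rightarrow> 'a mla_term \<Rightarrow> 'a mla_term"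
  where "Conj s t \<equiv> Mul (Mul s t) (Inv s)"

inductive mla_eqv :: "'a mla_term \<Rightarrow> 'a mla_term \<Rightarrow> bool" where
  eqv_refl: "mla_eqv s s"
| eqv_sym: "mla_eqv s t \<Longrightarrow> mla_eqv t s"
| eqv_trans: "\<lbrakk>mla_eqv s t; mla_eqv t u\<rbrakk> \<Longrightarrow> mla_eqv s u"
| eqv_Inv: "mla_eqv s t \<Longrightarrow> mla_eqv (Inv s) (Inv t)"
| eqv_Mul: "\<lbrakk>mla_eqv s s'; mla_eqv t t'\<rbrakk> \<Longrightarrow> mla_eqv (Mul s t) (Mul s' t')"
| eqv_Lie: "\<lbrakk>mla_eqv s s'; mla_eqv t t'\<rbrakk> \<Longrightarrow> mla_eqv (Lie s t) (Lie s' t')"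
| eqv_assoc: "mla_eqv (Mul (Mul s t) u) (Mul s (Mul t u))"
| eqv_l_one: "mla_eqv (Mul One s) s"
| eqv_l_inv: "mla_eqv (Mul (Inv s) s) One"
| eqv_lie_self: "mla_eqv (Lie s s) One"
| eqv_lie_right: "mla_eqv (Lie s (Mul t u)) (Mul (Lie s t) (Conj t (Lie s u)))"
| eqv_lie_left: "mla_eqv (Lie (Mul s t) u) (Mul (Conj s (Lie t u)) (Lie s u))"
| eqv_jacobi: "mla_eqv
    (Mul (Mul (Lie (Lie s t) (Conj t u)) (Lie (Lie t u) (Conj u s))) (Lie (Lie u s) (Conj s t))) One"
| eqv_lie_conj: "mla_eqv (Conj u (Lie s t)) (Lie (Conj u s) (Conj u t))"

quotient_type 'a free_mla = "'a mla_term" / mla_eqv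
  by (intro equivpI reflpI sympI transpI) (blast intro: eqv_refl eqv_sym eqv_trans)+

lift_definition fr_one :: "'a free_mla" is One .
lift_definition fr_inv :: "'a free_mla \<Rightarrow> 'a free_mla" is Inv by (rule eqv_Inv)
lift_definition fr_mult :: "'a free_mla \<Rightarrow> 'a free_mla \<Rightarrow> 'a free_mla" is Mul by (rule eqv_Mul)
lift_definition fr_lie :: "'a free_mla \<Rightarrow> 'a free_mla \<Rightarrow> 'a free_mla" is Lie by (rule eqv_Lie)
lift_definition fr_var :: "'a \<Rightarrow> 'a free_mla" is Var .

definition Free_mla :: "'a set \<Rightarrow> 'a free_mla mult_lie"
  where "Free_mla X = \<lparr>carrier = {abs_free_mla t | t. vars t \<subseteq> X},
    mult = fr_mult, one = fr_one, lie = fr_lie\<rparr>"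

text \<open>The universal property of a free object on \<open>X\<close>, against targets whose underlying type
  is \<open>'c\<close>.\<close>

definition universal_on :: "'c itself \<Rightarrow> 'a mult_lie \<Rightarrow> 'a set \<Rightarrow> bool"
  where "universal_on TYPE('c) F X \<longleftrightarrow>
    (\<forall>(H :: 'c mult_lie) f. mult_lie_algebra H \<and> f \<in> X \<rightarrow> carrier H \<longrightarrow>
      (\<exists>h\<in>mla_hom F H. (\<forall>x\<in>X. h x = f x) \<and>
        (\<forall>h'\<in>mla_hom F H. (\<forall>x\<in>X. h' x = f x) \<longrightarrow> (\<forall>u\<in>carrier F. h' u = h u))))"

text \<open>HOL cannot quantify over the types of the targets inside a definition. The two types below
  suffice: by \<open>free_on_universal\<close> the property then holds for targets of every type.\<close>

definition free_on :: "'a mult_lie \<Rightarrow> 'a set \<Rightarrow> bool"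
  where "free_on F X \<longleftrightarrow> mult_lie_algebra F \<and> X \<subseteq> carrier F \<and>
    universal_on TYPE('a) F X \<and> universal_on TYPE('a free_mla) F X"

definition free_presentation :: "'a set \<Rightarrow> 'a mult_lie \<Rightarrow> ('a \<Rightarrow> 'b) \<Rightarrow> 'b mult_lie \<Rightarrow> bool"
  where "free_presentation R F p G \<longleftrightarrow> short_exact R F p G \<and> (\<exists>X. free_on F X)"

subsection \<open>Adequacy of the definition of free objects\<close>

lemma fr_simps:
  "fr_mult (abs_free_mla s) (abs_free_mla t) = abs_free_mla (Mul s t)"
  "fr_lie (abs_free_mla s) (abs_free_mla t) = abs_free_mla (Lie s t)"
  "fr_inv (abs_free_mla s) = abs_free_mla (Inv s)"
  "fr_one = abs_free_mla One"
  "fr_var x = abs_free_mla (Var x)"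
  by (simp_all add: fr_mult.abs_eq fr_lie.abs_eq fr_inv.abs_eq fr_one.abs_eq fr_var.abs_eq)

lemma Free_mla_simps [simp]:
  "carrier (Free_mla X) = {abs_free_mla t | t. vars t \<subseteq> X}"
  "x \<otimes>\<^bsub>Free_mla X\<^esub> y = fr_mult x y"
  "x \<star>\<^bsub>Free_mla X\<^esub> y = fr_lie x y"
  "\<one>\<^bsub>Free_mla X\<^esub> = fr_one"
  by (simp_all add: Free_mla_def)

lemma group_Free_mla: "group (Free_mla X)"
proof (rule groupI)
  show "\<one>\<^bsub>Free_mla X\<^esub> \<in> carrier (Free_mla X)"
    by (auto simp: fr_simps intro!: exI[of _ One])
next
  fix x y assume "x \<in> carrier (Free_mla X)" "y \<in> carrier (Free_mla X)"
  then obtain s t where "x = abs_free_mla s" "y = abs_free_mla t" "vars s \<subseteq> X" "vars t \<subseteq> X"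
    by auto
  then show "x \<otimes>\<^bsub>Free_mla X\<^esub> y \<in> carrier (Free_mla X)"
    by (auto simp: fr_simps intro!: exI[of _ "Mul s t"])
next
  fix x assume "x \<in> carrier (Free_mla X)"
  then obtain s where s: "x = abs_free_mla s" "vars s \<subseteq> X"
    by auto
  then have "abs_free_mla (Inv s) \<in> carrier (Free_mla X)"
    by (auto intro!: exI[of _ "Inv s"])
  moreover have "abs_free_mla (Inv s) \<otimes>\<^bsub>Free_mla X\<^esub> x = \<one>\<^bsub>Free_mla X\<^esub>"
    by (simp add: s fr_simps free_mla.abs_eq_iff eqv_l_inv)
  ultimately show "\<exists>y\<in>carrier (Free_mla X). y \<otimes>\<^bsub>Free_mla X\<^esub> x = \<one>\<^bsub>Free_mla X\<^esub>"
    by blast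
next
  fix x assume "x \<in> carrier (Free_mla X)"
  then show "\<one>\<^bsub>Free_mla X\<^esub> \<otimes>\<^bsub>Free_mla X\<^esub> x = x"
    by (auto simp: fr_simps free_mla.abs_eq_iff intro: eqv_l_one)
next
  fix x y z
  assume "x \<in> carrier (Free_mla X)" "y \<in> carrier (Free_mla X)" "z \<in> carrier (Free_mla X)"
  then show "x \<otimes>\<^bsub>Free_mla X\<^esub> y \<otimes>\<^bsub>Free_mla X\<^esub> z = x \<otimes>\<^bsub>Free_mla X\<^esub> (y \<otimes>\<^bsub>Free_mla X\<^esub> z)"
    by (auto simp: fr_simps free_mla.abs_eq_iff intro: eqv_assoc)
qed

lemma inv_Free_mla:
  assumes "vars t \<subseteq> X"
  shows "inv\<^bsub>Free_mla X\<^esub> (abs_free_mla t) = abs_free_mla (Inv t)"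
proof -
  interpret group "Free_mla X" by (rule group_Free_mla)
  show ?thesis
  proof (rule inv_equality)
    show "abs_free_mla (Inv t) \<otimes>\<^bsub>Free_mla X\<^esub> abs_free_mla t = \<one>\<^bsub>Free_mla X\<^esub>"
      by (simp add: fr_simps free_mla.abs_eq_iff eqv_l_inv)
    show "abs_free_mla t \<in> carrier (Free_mla X)" using assms by auto
    show "abs_free_mla (Inv t) \<in> carrier (Free_mla X)"
      using assms by (auto intro!: exI[of _ "Inv t"])
  qed
qed

lemma conj_Free_mla:
  assumes "vars s \<subseteq> X"
  shows "conj_by (Free_mla X) (abs_free_mla s) (abs_free_mla t) = abs_free_mla (Conj s t)"
  by (simp add: conj_by_def inv_Free_mla[OF assms] fr_simps)

lemma mult_lie_algebra_Free_mla: "mult_lie_algebra (Free_mla X)"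
proof -
  interpret group "Free_mla X" by (rule group_Free_mla)
  have cl: "fr_lie x y \<in> carrier (Free_mla X)"
    if "x \<in> carrier (Free_mla X)" "y \<in> carrier (Free_mla X)" for x y
  proof -
    from that obtain s t where "x = abs_free_mla s" "y = abs_free_mla t" "vars s \<subseteq> X" "vars t \<subseteq> X"
      by auto
    then show ?thesis
      by (auto simp: fr_simps intro!: exI[of _ "Lie s t"])
  qed
  show ?thesis
  proof unfold_locales
    fix x y assume "x \<in> carrier (Free_mla X)" "y \<in> carrier (Free_mla X)"
    then show "x \<star>\<^bsub>Free_mla X\<^esub> y \<in> carrier (Free_mla X)"
      using cl by simp
  next
    fix x assume "x \<in> carrier (Free_mla X)"
    then show "x \<star>\<^bsub>Free_mla X\<^esub> x = \<one>\<^bsub>Free_mla X\<^esub>"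
      by (auto simp: fr_simps free_mla.abs_eq_iff intro: eqv_lie_self)
  next
    fix x y z
    assume "x \<in> carrier (Free_mla X)" "y \<in> carrier (Free_mla X)" "z \<in> carrier (Free_mla X)"
    then show "x \<star>\<^bsub>Free_mla X\<^esub> (y \<otimes>\<^bsub>Free_mla X\<^esub> z)
      = (x \<star>\<^bsub>Free_mla X\<^esub> y) \<otimes>\<^bsub>Free_mla X\<^esub> conj_by (Free_mla X) y (x \<star>\<^bsub>Free_mla X\<^esub> z)"
      by (auto simp: fr_simps conj_Free_mla free_mla.abs_eq_iff intro: eqv_lie_right)
  next
    fix x y z
    assume "x \<in> carrier (Free_mla X)" "y \<in> carrier (Free_mla X)" "z \<in> carrier (Free_mla X)"
    then show "(x \<otimes>\<^bsub>Free_mla X\<^esub> y) \<star>\<^bsub>Free_mla X\<^esub> z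
      = conj_by (Free_mla X) x (y \<star>\<^bsub>Free_mla X\<^esub> z) \<otimes>\<^bsub>Free_mla X\<^esub> (x \<star>\<^bsub>Free_mla X\<^esub> z)"
      by (auto simp: fr_simps conj_Free_mla free_mla.abs_eq_iff intro: eqv_lie_left)
  next
    fix x y z
    assume "x \<in> carrier (Free_mla X)" "y \<in> carrier (Free_mla X)" "z \<in> carrier (Free_mla X)"
    then show "((x \<star>\<^bsub>Free_mla X\<^esub> y) \<star>\<^bsub>Free_mla X\<^esub> conj_by (Free_mla X) y z) \<otimes>\<^bsub>Free_mla X\<^esub>
        ((y \<star>\<^bsub>Free_mla X\<^esub> z) \<star>\<^bsub>Free_mla X\<^esub> conj_by (Free_mla X) z x) \<otimes>\<^bsub>Free_mla X\<^esub>
        ((z \<star>\<^bsub>Free_mla X\<^esub> x) \<star>\<^bsub>Free_mla X\<^esub> conj_by (Free_mla X) x y) = \<one>\<^bsub>Free_mla X\<^esub>"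
      by (auto simp: fr_simps conj_Free_mla free_mla.abs_eq_iff intro: eqv_jacobi)
  next
    fix x y z
    assume "x \<in> carrier (Free_mla X)" "y \<in> carrier (Free_mla X)" "z \<in> carrier (Free_mla X)"
    then show "conj_by (Free_mla X) z (x \<star>\<^bsub>Free_mla X\<^esub> y)
      = conj_by (Free_mla X) z x \<star>\<^bsub>Free_mla X\<^esub> conj_by (Free_mla X) z y"
      by (auto simp: fr_simps conj_Free_mla free_mla.abs_eq_iff intro: eqv_lie_conj)
  qed
qed

primrec mla_eval :: "'b mult_lie \<Rightarrow> ('a \<Rightarrow> 'b) \<Rightarrow> 'a mla_term \<Rightarrow> 'b" where
  "mla_eval H f (Var x) = f x"
| "mla_eval H f One = \<one>\<^bsub>H\<^esub>"
| "mla_eval H f (Inv s) = inv\<^bsub>H\<^esub> (mla_eval H f s)"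
| "mla_eval H f (Mul s t) = mla_eval H f s \<otimes>\<^bsub>H\<^esub> mla_eval H f t"
| "mla_eval H f (Lie s t) = mla_eval H f s \<star>\<^bsub>H\<^esub> mla_eval H f t"

context
  fixes H :: "'b mult_lie" and f :: "'a \<Rightarrow> 'b"
  assumes H: "mult_lie_algebra H" and f: "\<And>x. f x \<in> carrier H"
begin

interpretation H: mult_lie_algebra H by (rule H)

lemma mla_eval_closed: "mla_eval H f t \<in> carrier H"
  by (induction t) (auto simp: f H.lie_closed)

lemma mla_eval_eqv: "mla_eqv s t \<Longrightarrow> mla_eval H f s = mla_eval H f t"
proof (induction rule: mla_eqv.induct)
  case (eqv_lie_right s t u)
  then show ?case
    using H.lie_mult_right[of "mla_eval H f s" "mla_eval H f t" "mla_eval H f u"]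
    by (simp add: mla_eval_closed conj_by_def)
next
  case (eqv_lie_left s t u)
  then show ?case
    using H.lie_mult_left[of "mla_eval H f s" "mla_eval H f t" "mla_eval H f u"]
    by (simp add: mla_eval_closed conj_by_def)
next
  case (eqv_jacobi s t u)
  then show ?case
    using H.lie_jacobi[of "mla_eval H f s" "mla_eval H f t" "mla_eval H f u"]
    by (simp add: mla_eval_closed conj_by_def)
next
  case (eqv_lie_conj u s t)
  then show ?case
    using H.lie_conj[of "mla_eval H f s" "mla_eval H f t" "mla_eval H f u"]
    by (simp add: mla_eval_closed conj_by_def)
qed (simp_all add: mla_eval_closed H.m_assoc H.lie_self)

end

lemma mla_hom_one_inv:
  assumes "h \<in> mla_hom G H" "mult_lie_algebra G" "mult_lie_algebra H"
  shows "h \<one>\<^bsub>G\<^esub> = \<one>\<^bsub>H\<^esub>" "x \<in> carrier G \<Longrightarrow> h (inv\<^bsub>G\<^esub> x) = inv\<^bsub>H\<^esub> (h x)"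
proof -
  interpret group_hom G H h
    using assms by (auto simp: group_hom_def group_hom_axioms_def mla_hom_def mult_lie_algebra_def)
  show "h \<one>\<^bsub>G\<^esub> = \<one>\<^bsub>H\<^esub>" "x \<in> carrier G \<Longrightarrow> h (inv\<^bsub>G\<^esub> x) = inv\<^bsub>H\<^esub> (h x)"
    by auto
qed

lemma mla_hom_simps:
  assumes "h \<in> mla_hom G H" "x \<in> carrier G" "y \<in> carrier G"
  shows "h (x \<otimes>\<^bsub>G\<^esub> y) = h x \<otimes>\<^bsub>H\<^esub> h y" "h (x \<star>\<^bsub>G\<^esub> y) = h x \<star>\<^bsub>H\<^esub> h y" "h x \<in> carrier H"
  using assms by (auto simp: mla_hom_def hom_def)

lemma mla_hom_comp:
  assumes "h \<in> mla_hom G H" "k \<in> mla_hom H K"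
  shows "k \<circ> h \<in> mla_hom G K"
  using assms by (auto simp: mla_hom_def hom_def Pi_iff)

lemma mla_hom_id: "mult_lie_algebra G \<Longrightarrow> id \<in> mla_hom G G"
  by (auto simp: mla_hom_def hom_def)

lemma mla_hom_Free_mla_eval:
  assumes H: "mult_lie_algebra H" and h: "h \<in> mla_hom (Free_mla X) H"
    and ext: "\<And>x. x \<in> X \<Longrightarrow> h (fr_var x) = f x"
  shows "vars t \<subseteq> X \<Longrightarrow> h (abs_free_mla t) = mla_eval H f t"
proof (induction t)
  case (Var x)
  then show ?case using ext by (simp add: fr_simps)
next
  case One
  then show ?case
    using mla_hom_one_inv(1)[OF h mult_lie_algebra_Free_mla H] by (simp add: fr_simps)
next
  case (Inv t)
  then have "abs_free_mla t \<in> carrier (Free_mla X)" by auto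
  from mla_hom_one_inv(2)[OF h mult_lie_algebra_Free_mla H this] Inv
  show ?case by (simp add: inv_Free_mla)
next
  case (Mul s t)
  then have "abs_free_mla s \<in> carrier (Free_mla X)" "abs_free_mla t \<in> carrier (Free_mla X)"
    by auto
  from mla_hom_simps(1)[OF h this] Mul show ?case by (simp add: fr_simps)
next
  case (Lie s t)
  then have "abs_free_mla s \<in> carrier (Free_mla X)" "abs_free_mla t \<in> carrier (Free_mla X)"
    by auto
  from mla_hom_simps(2)[OF h this] Lie show ?case by (simp add: fr_simps)
qed

lemma Free_mla_extend:
  assumes H: "mult_lie_algebra H" and f: "f \<in> X \<rightarrow> carrier H"
  shows "\<exists>h\<in>mla_hom (Free_mla X) H. \<forall>x\<in>X. h (fr_var x) = f x"
proof -
  interpret H: mult_lie_algebra H by (rule H)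
  define f' where "f' x = (if x \<in> X then f x else \<one>\<^bsub>H\<^esub>)" for x
  have f': "f' x \<in> carrier H" for x using f by (auto simp: f'_def)
  define h where "h u = mla_eval H f' (rep_free_mla u)" for u
  have h: "h (abs_free_mla t) = mla_eval H f' t" for t
  proof -
    have "mla_eqv (rep_free_mla (abs_free_mla t)) t"
      using Quotient3_free_mla by (metis Quotient3_abs_rep free_mla.abs_eq_iff)
    from mla_eval_eqv[OF H f' this] show ?thesis by (simp add: h_def)
  qed
  have "h \<in> mla_hom (Free_mla X) H"
    by (auto simp: mla_hom_def hom_def fr_simps h mla_eval_closed[OF H f'])
  moreover have "\<forall>x\<in>X. h (fr_var x) = f x"
    by (auto simp: fr_simps h f'_def)
  ultimately show ?thesis by blast
qed

lemma Free_mla_hom_unique: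
  assumes "mult_lie_algebra H" "h \<in> mla_hom (Free_mla X) H" "h' \<in> mla_hom (Free_mla X) H"
    and "\<And>x. x \<in> X \<Longrightarrow> h' (fr_var x) = h (fr_var x)" and "u \<in> carrier (Free_mla X)"
  shows "h' u = h u"
  using assms mla_hom_Free_mla_eval[of H h X "\<lambda>x. h (fr_var x)"]
    mla_hom_Free_mla_eval[of H h' X "\<lambda>x. h (fr_var x)"] by auto

lemma universal_on_Free_mla: "universal_on TYPE('c) (Free_mla X) (fr_var ` X)"
  unfolding universal_on_def
proof (intro allI impI, elim conjE)
  fix H :: "'c mult_lie" and f
  assume H: "mult_lie_algebra H" and f: "f \<in> fr_var ` X \<rightarrow> carrier H"
  then have "f \<circ> fr_var \<in> X \<rightarrow> carrier H" by auto
  from Free_mla_extend[OF H this] obtain h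
    where h: "h \<in> mla_hom (Free_mla X) H" "\<forall>x\<in>X. h (fr_var x) = f (fr_var x)" by auto
  show "\<exists>h\<in>mla_hom (Free_mla X) H. (\<forall>x\<in>fr_var ` X. h x = f x) \<and>
    (\<forall>h'\<in>mla_hom (Free_mla X) H. (\<forall>x\<in>fr_var ` X. h' x = f x) \<longrightarrow>
      (\<forall>u\<in>carrier (Free_mla X). h' u = h u))"
  proof (intro bexI[OF _ h(1)] conjI ballI impI)
    fix h' u assume "h' \<in> mla_hom (Free_mla X) H" "\<forall>x\<in>fr_var ` X. h' x = f x"
      "u \<in> carrier (Free_mla X)"
    then show "h' u = h u" using Free_mla_hom_unique[OF H h(1)] h(2) by auto
  qed (use h(2) in auto)
qed

lemma free_on_Free_mla: "free_on (Free_mla X) (fr_var ` X)"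
proof -
  have "fr_var ` X \<subseteq> carrier (Free_mla X)"
    by (auto simp: fr_simps intro!: exI[of _ "Var _"])
  then show ?thesis
    by (simp only: free_on_def universal_on_Free_mla mult_lie_algebra_Free_mla)
qed

lemma free_on_universal:
  fixes F :: "'a mult_lie"
  assumes "free_on F X"
  shows "universal_on TYPE('c) F X"
proof -
  have F: "mult_lie_algebra F" and X: "X \<subseteq> carrier F"
    and u1: "universal_on TYPE('a) F X" and u2: "universal_on TYPE('a free_mla) F X"
    using assms by (auto simp: free_on_def)
  have "fr_var \<in> X \<rightarrow> carrier (Free_mla X)"
    by (auto simp: fr_simps intro!: exI[of _ "Var _"])
  with u2 mult_lie_algebra_Free_mla obtain h
    where h: "h \<in> mla_hom F (Free_mla X)" "\<forall>x\<in>X. h x = fr_var x"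
    unfolding universal_on_def by blast
  have "id \<in> X \<rightarrow> carrier F" using X by auto
  from Free_mla_extend[OF F this] obtain g
    where g: "g \<in> mla_hom (Free_mla X) F" "\<forall>x\<in>X. g (fr_var x) = x" by auto
  have gh: "g (h u) = u" if "u \<in> carrier F" for u
  proof -
    from u1 F X obtain k where k: "\<And>h'. h' \<in> mla_hom F F \<Longrightarrow> \<forall>x\<in>X. h' x = x \<Longrightarrow>
        \<forall>u\<in>carrier F. h' u = k u"
      unfolding universal_on_def by (metis \<open>id \<in> X \<rightarrow> carrier F\<close> id_apply)
    have "(g \<circ> h) u = k u"
      using k[OF mla_hom_comp[OF h(1) g(1)]] h(2) g(2) that by auto
    moreover have "id u = k u"
      using k[OF mla_hom_id[OF F]] that by auto
    ultimately show ?thesis by simp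
  qed
  show ?thesis
    unfolding universal_on_def
  proof (intro allI impI, elim conjE)
    fix H :: "'c mult_lie" and f
    assume H: "mult_lie_algebra H" and f: "f \<in> X \<rightarrow> carrier H"
    from Free_mla_extend[OF H f] obtain k
      where k: "k \<in> mla_hom (Free_mla X) H" "\<forall>x\<in>X. k (fr_var x) = f x" by auto
    show "\<exists>h\<in>mla_hom F H. (\<forall>x\<in>X. h x = f x) \<and>
      (\<forall>h'\<in>mla_hom F H. (\<forall>x\<in>X. h' x = f x) \<longrightarrow> (\<forall>u\<in>carrier F. h' u = h u))"
    proof (intro bexI[OF _ mla_hom_comp[OF h(1) k(1)]] conjI ballI impI)
      fix h' u assume h': "h' \<in> mla_hom F H" "\<forall>x\<in>X. h' x = f x" and u: "u \<in> carrier F"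
      have "(h' \<circ> g) (h u) = k (h u)"
        using Free_mla_hom_unique[OF H k(1) mla_hom_comp[OF g(1) h'(1)]] k(2) g(2) h'(2)
          mla_hom_simps(3)[OF h(1) u u] by auto
      then show "h' u = (k \<circ> h) u" by (simp add: gh[OF u])
    qed (use h(2) k(2) in auto)
  qed
qed

section \<open>The Schur multiplier and covers\<close>

definition presentation_multiplier :: "'a mult_lie \<Rightarrow> 'a set \<Rightarrow> 'a set mult_lie"
  where "presentation_multiplier F R =
    mla_quotient (F\<lparr>carrier := M_bracket F (carrier F) (carrier F) \<inter> R\<rparr>) (M_bracket F R (carrier F))"

text \<open>The multiplier does not depend, up to isomorphism, on the free presentation. It is
  computed here from the presentation of \<open>G\<close> by the free algebra on the underlying set of \<open>G\<close>;
  the choice operator is harmless, since such a homomorphism exists and is determined on the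
  carrier.\<close>

definition canonical_projection :: "'a mult_lie \<Rightarrow> 'a free_mla \<Rightarrow> 'a"
  where "canonical_projection G =
    (SOME p. p \<in> mla_hom (Free_mla (carrier G)) G \<and> (\<forall>g\<in>carrier G. p (fr_var g) = g))"

lemma free_presentation_canonical:
  assumes G: "mult_lie_algebra G"
  shows "free_presentation (kernel (Free_mla (carrier G)) G (canonical_projection G))
    (Free_mla (carrier G)) (canonical_projection G) G"
proof -
  define p where "p = canonical_projection G"
  have "\<exists>p. p \<in> mla_hom (Free_mla (carrier G)) G \<and> (\<forall>g\<in>carrier G. p (fr_var g) = g)"
    using Free_mla_extend[OF G, of id "carrier G"] by auto
  then have p: "p \<in> mla_hom (Free_mla (carrier G)) G" "\<forall>g\<in>carrier G. p (fr_var g) = g"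
    unfolding p_def canonical_projection_def by (rule someI2_ex, blast)+
  have "p ` carrier (Free_mla (carrier G)) = carrier G"
  proof
    show "p ` carrier (Free_mla (carrier G)) \<subseteq> carrier G"
      using mla_hom_simps(3)[OF p(1)] by blast
    have "fr_var g \<in> carrier (Free_mla (carrier G))" if "g \<in> carrier G" for g
      using that by (auto simp: fr_simps intro!: exI[of _ "Var _"])
    then show "carrier G \<subseteq> p ` carrier (Free_mla (carrier G))"
      using p(2) by (metis image_eqI subsetI)
  qed
  then show ?thesis
    unfolding free_presentation_def short_exact_def p_def[symmetric]
    using p(1) G mult_lie_algebra_Free_mla free_on_Free_mla by blast
qed

definition schur_multiplier :: "'a mult_lie \<Rightarrow> 'a free_mla set mult_lie"
  where "schur_multiplier G = presentation_multiplier (Free_mla (carrier G))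
    (kernel (Free_mla (carrier G)) G (canonical_projection G))"

definition central_extension :: "'a set \<Rightarrow> 'a mult_lie \<Rightarrow> ('a \<Rightarrow> 'b) \<Rightarrow> 'b mult_lie \<Rightarrow> bool"
  where "central_extension N K p G \<longleftrightarrow> short_exact N K p G \<and> N \<subseteq> mla_center K"

definition stem_extension :: "'a set \<Rightarrow> 'a mult_lie \<Rightarrow> ('a \<Rightarrow> 'b) \<Rightarrow> 'b mult_lie \<Rightarrow> bool"
  where "stem_extension N K p G \<longleftrightarrow>
    central_extension N K p G \<and> N \<subseteq> M_bracket K (carrier K) (carrier K)"

definition stem_cover :: "'a set \<Rightarrow> 'a mult_lie \<Rightarrow> ('a \<Rightarrow> 'b) \<Rightarrow> 'b mult_lie \<Rightarrow> bool"
  where "stem_cover N K p G \<longleftrightarrow>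
    stem_extension N K p G \<and> mla_isomorphic (K\<lparr>carrier := N\<rparr>) (schur_multiplier G)"

definition is_cover :: "'a mult_lie \<Rightarrow> 'b mult_lie \<Rightarrow> bool"
  where "is_cover K G \<longleftrightarrow> (\<exists>N p. stem_cover N K p G)"

end

theory Submission
  imports Defs "HOL-Algebra.SndIsomorphismGrp"
begin

text \<open>Put \<open>Q = F / \<^sup>M[R, F]\<close>, a central extension of \<open>G\<close>. The algebra in question is
  \<open>Q' = \<^sup>M[Q, Q]\<close>. Since \<open>G\<close> is perfect, every element of \<open>Q\<close> is an element of \<open>Q'\<close> times a
  central one; central factors do not affect \<open>\<star>\<close> and commutators, so \<open>Q'\<close> is perfect and maps
  onto \<open>G\<close>, which makes it a stem extension. By freeness \<open>Q\<close> maps over \<open>G\<close> to every central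
  extension of \<open>G\<close>, and an endomorphism of \<open>Q\<close> over \<open>G\<close> moves elements by central factors only,
  hence fixes \<open>Q'\<close> pointwise. Comparing two free presentations in both directions identifies the
  kernels of \<open>Q' \<rightarrow> G\<close>, hence the kernel is the Schur multiplier.\<close>

section \<open>Multiplicative Lie algebras and the bracket of ideals\<close>

text \<open>The word is literally the one generating \<open>commutator_subgroup\<close>, so that
  definition can be folded with \<open>commutator_def[symmetric]\<close>.\<close>

definition commutator :: "('a, 'm) monoid_scheme \<Rightarrow> 'a \<Rightarrow> 'a \<Rightarrow> 'a"
  where "commutator G x y = x \<otimes>\<^bsub>G\<^esub> y \<otimes>\<^bsub>G\<^esub> inv\<^bsub>G\<^esub> x \<otimes>\<^bsub>G\<^esub> inv\<^bsub>G\<^esub> y"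

definition mla_ideal :: "'a mult_lie \<Rightarrow> 'a set \<Rightarrow> bool"
  where "mla_ideal G H \<longleftrightarrow> H \<lhd> G \<and> (\<forall>x\<in>carrier G. \<forall>y\<in>H. x \<star>\<^bsub>G\<^esub> y \<in> H)"

text \<open>Common abstraction of the two kinds of bracket arguments that occur, the whole carrier
  and a normal subgroup. It is all that is needed to make the generators of a bracket stable under
  conjugation.\<close>

definition conj_invariant :: "('a, 'm) monoid_scheme \<Rightarrow> 'a set \<Rightarrow> bool"
  where "conj_invariant G A \<longleftrightarrow> A \<subseteq> carrier G \<and> (\<forall>g\<in>carrier G. \<forall>a\<in>A. conj_by G g a \<in> A)"

section \<open>Conjugation and commutators in a group\<close>

context group
begin

lemma conj_by_closed [simp]:
  "x \<in> carrier G \<Longrightarrow> y \<in> carrier G \<Longrightarrow> conj_by G x y \<in> carrier G"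
  by (simp add: conj_by_def)

lemma conj_by_mult:
  "x \<in> carrier G \<Longrightarrow> y \<in> carrier G \<Longrightarrow> z \<in> carrier G
    \<Longrightarrow> conj_by G x (y \<otimes> z) = conj_by G x y \<otimes> conj_by G x z"
  by (simp add: conj_by_def m_assoc inv_solve_left' flip: m_assoc[of "inv x" x])

lemma conj_by_one: "x \<in> carrier G \<Longrightarrow> conj_by G x \<one> = \<one>"
  by (simp add: conj_by_def)

lemma conj_by_eq_one_iff:
  assumes "x \<in> carrier G" "y \<in> carrier G"
  shows "conj_by G x y = \<one> \<longleftrightarrow> y = \<one>"
proof
  assume "conj_by G x y = \<one>"
  then have "x \<otimes> y = x"
    using assms unfolding conj_by_def by (metis inv_solve_right' l_one m_closed one_closed)
  then show "y = \<one>" using assms by (simp add: r_cancel_one)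
qed (use assms in \<open>simp add: conj_by_def\<close>)

lemma commutator_closed [simp]:
  "x \<in> carrier G \<Longrightarrow> y \<in> carrier G \<Longrightarrow> commutator G x y \<in> carrier G"
  by (simp add: commutator_def)

lemma commutator_eq_one_iff:
  assumes "x \<in> carrier G" "y \<in> carrier G"
  shows "commutator G x y = \<one> \<longleftrightarrow> x \<otimes> y = y \<otimes> x"
proof -
  have "commutator G x y = (x \<otimes> y) \<otimes> inv (y \<otimes> x)"
    using assms by (simp add: commutator_def m_assoc inv_mult_group)
  then show ?thesis
    using assms by (metis inv_equality inv_inv inv_closed m_closed r_inv)
qed

lemma conj_by_commutator:
  assumes "g \<in> carrier G" "x \<in> carrier G" "y \<in> carrier G"
  shows "conj_by G g (commutator G x y) = commutator G (conj_by G g x) (conj_by G g y)"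
proof -
  have inv: "inv (conj_by G g u) = conj_by G g (inv u)" if "u \<in> carrier G" for u
    using assms that by (simp add: conj_by_def m_assoc inv_mult_group)
  show ?thesis
    using assms by (simp add: commutator_def inv conj_by_mult)
qed

text \<open>Central factors collect at the right: both products of the two elements acquire the same
  factor \<open>c \<otimes> d\<close>, which cancels in the form
  \<open>(x \<otimes> y) \<otimes> inv (y \<otimes> x)\<close> of the commutator.\<close>

lemma commutator_mult_central:
  assumes "a \<in> carrier G" "b \<in> carrier G" "c \<in> carrier G" "d \<in> carrier G"
    and c: "\<And>x. x \<in> carrier G \<Longrightarrow> c \<otimes> x = x \<otimes> c" and d: "\<And>x. x \<in> carrier G \<Longrightarrow> d \<otimes> x = x \<otimes> d"
  shows "commutator G (a \<otimes> c) (b \<otimes> d) = commutator G a b"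
proof -
  have "(a \<otimes> c) \<otimes> (b \<otimes> d) = (a \<otimes> b) \<otimes> (c \<otimes> d)"
    using assms(1-4) c by (metis m_assoc m_closed)
  moreover have "(b \<otimes> d) \<otimes> (a \<otimes> c) = (b \<otimes> a) \<otimes> (c \<otimes> d)"
    using assms(1-4) c d by (metis m_assoc m_closed)
  moreover have "commutator G x y = (x \<otimes> y) \<otimes> inv (y \<otimes> x)"
    if "x \<in> carrier G" "y \<in> carrier G" for x y
    using that by (simp add: commutator_def m_assoc inv_mult_group)
  moreover have "(a \<otimes> b) \<otimes> (c \<otimes> d) \<otimes> inv ((b \<otimes> a) \<otimes> (c \<otimes> d)) = (a \<otimes> b) \<otimes> inv (b \<otimes> a)"
  proof -
    have "(a \<otimes> b) \<otimes> (c \<otimes> d) \<otimes> inv ((b \<otimes> a) \<otimes> (c \<otimes> d))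
        = (a \<otimes> b) \<otimes> ((c \<otimes> d) \<otimes> inv (c \<otimes> d)) \<otimes> inv (b \<otimes> a)"
      using assms(1-4) by (simp only: inv_mult_group m_assoc m_closed inv_closed)
    then show ?thesis using assms(1-4) by (simp only: r_inv r_one m_closed)
  qed
  ultimately show ?thesis using assms(1-4) by simp
qed

lemma conj_invariant_carrier: "conj_invariant G (carrier G)"
  by (simp add: conj_invariant_def)

lemma conj_invariant_normal: "N \<lhd> G \<Longrightarrow> conj_invariant G N"
  using normal_inv_iff[of N] subgroup.subset[of N G] by (auto simp: conj_invariant_def conj_by_def)

lemma normal_generate_conj:
  assumes "S \<subseteq> carrier G" "\<And>g s. g \<in> carrier G \<Longrightarrow> s \<in> S \<Longrightarrow> conj_by G g s \<in> S"
  shows "generate G S \<lhd> G"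
  using assms by (intro normal_generateI) (auto simp: conj_by_def)

end

text \<open>\<^const>\<open>M_bracket\<close> is only defined for records without further extension, so it cannot be
  used inside \<^locale>\<open>mult_lie_algebra\<close> itself.\<close>

locale mla = mult_lie_algebra G for G :: "'a mult_lie" (structure)
begin

lemma lie_one_right: "z \<in> carrier G \<Longrightarrow> z \<star> \<one> = \<one>"
  using lie_mult_right[of z \<one> \<one>] by (simp add: conj_by_def lie_closed)

text \<open>Expanding the trivial element \<open>(x \<otimes> y) \<star> (x \<otimes> y)\<close> by
  both product rules, the squares of \<open>x\<close> and \<open>y\<close> vanish and a conjugate of
  \<open>(y \<star> x) \<otimes> (x \<star> y)\<close> remains.\<close>

lemma lie_anticomm:
  assumes "x \<in> carrier G" "y \<in> carrier G"
  shows "x \<star> y = inv (y \<star> x)"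
proof -
  have "\<one> = (x \<otimes> y) \<star> (x \<otimes> y)" using assms by (simp add: lie_self)
  also have "\<dots> = conj_by G x (y \<star> x) \<otimes> conj_by G x (x \<star> y)"
    using assms by (simp add: lie_mult_left lie_mult_right lie_self[of x] lie_self[of y]
      lie_closed conj_by_one)
  also have "\<dots> = conj_by G x ((y \<star> x) \<otimes> (x \<star> y))"
    using assms by (simp add: conj_by_mult lie_closed)
  finally have "(y \<star> x) \<otimes> (x \<star> y) = \<one>"
    using conj_by_eq_one_iff[of x "(y \<star> x) \<otimes> (x \<star> y)"] assms lie_closed by simp
  then show ?thesis
    using assms inv_equality[of "y \<star> x" "x \<star> y"] lie_closed by simp (metis inv_equality inv_inv)
qed

lemma mla_ideal_left:
  assumes "mla_ideal G H" "x \<in> H" "y \<in> carrier G"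
  shows "x \<star> y \<in> H"
proof -
  have sub: "subgroup H G" using assms(1) by (auto simp: mla_ideal_def normal_imp_subgroup)
  have "y \<star> x \<in> H" using assms by (auto simp: mla_ideal_def)
  then have "inv (y \<star> x) \<in> H" using sub by (rule subgroup.m_inv_closed[rotated])
  then show ?thesis using lie_anticomm[of x y] assms subgroup.mem_carrier[OF sub] by simp
qed

text \<open>Axiom \<open>lie_conj\<close> sends generators to generators, so the generated subgroup
  is normal.\<close>

lemma lie_subgroup_normal:
  assumes "conj_invariant G A" "conj_invariant G B"
  shows "lie_subgroup G A B \<lhd> G"
  unfolding lie_subgroup_def
proof (rule normal_generate_conj)
  show "{a \<star> b |a b. a \<in> A \<and> b \<in> B} \<subseteq> carrier G"
    using assms by (auto simp: conj_invariant_def intro!: lie_closed)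
  fix g s assume g: "g \<in> carrier G" and "s \<in> {a \<star> b |a b. a \<in> A \<and> b \<in> B}"
  then obtain a b where s: "s = a \<star> b" "a \<in> A" "b \<in> B" by auto
  with g assms have "conj_by G g s = conj_by G g a \<star> conj_by G g b"
    by (auto simp: conj_invariant_def intro!: lie_conj)
  with g s assms show "conj_by G g s \<in> {a \<star> b |a b. a \<in> A \<and> b \<in> B}"
    by (simp add: conj_invariant_def) blast
qed

lemma commutator_subgroup_normal:
  assumes "conj_invariant G A" "conj_invariant G B"
  shows "commutator_subgroup G A B \<lhd> G"
  unfolding commutator_subgroup_def commutator_def[symmetric]
proof (rule normal_generate_conj)
  show "{commutator G a b |a b. a \<in> A \<and> b \<in> B} \<subseteq> carrier G"
    using assms by (auto simp: conj_invariant_def subset_iff)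
  fix g s assume g: "g \<in> carrier G" and "s \<in> {commutator G a b |a b. a \<in> A \<and> b \<in> B}"
  then obtain a b where s: "s = commutator G a b" "a \<in> A" "b \<in> B" by auto
  with g assms have "conj_by G g s = commutator G (conj_by G g a) (conj_by G g b)"
    by (auto simp: conj_invariant_def intro!: conj_by_commutator)
  with g s assms show "conj_by G g s \<in> {commutator G a b |a b. a \<in> A \<and> b \<in> B}"
    by (simp add: conj_invariant_def) blast
qed

lemma M_bracket_normal:
  "conj_invariant G A \<Longrightarrow> conj_invariant G B \<Longrightarrow> M_bracket G A B \<lhd> G"
  unfolding M_bracket_def
  by (intro normal_subgroup_set_mult_closed lie_subgroup_normal commutator_subgroup_normal)

lemma M_bracket_subgroup:
  "conj_invariant G A \<Longrightarrow> conj_invariant G B \<Longrightarrow> subgroup (M_bracket G A B) G"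
  by (intro normal_imp_subgroup M_bracket_normal)

lemma lie_in_M_bracket:
  assumes "a \<in> A" "b \<in> B" "A \<subseteq> carrier G" "B \<subseteq> carrier G"
  shows "a \<star> b \<in> M_bracket G A B"
proof -
  have "a \<star> b \<in> lie_subgroup G A B"
    unfolding lie_subgroup_def using assms by (auto intro: generate.incl)
  moreover have "\<one> \<in> commutator_subgroup G A B"
    unfolding commutator_subgroup_def by (rule generate.one)
  moreover have "a \<star> b = (a \<star> b) \<otimes> \<one>" using assms lie_closed by (auto simp: subset_iff)
  ultimately show ?thesis unfolding M_bracket_def set_mult_def by blast
qed

lemma commutator_in_M_bracket:
  assumes "a \<in> A" "b \<in> B" "A \<subseteq> carrier G" "B \<subseteq> carrier G"
  shows "commutator G a b \<in> M_bracket G A B"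
proof -
  have "commutator G a b \<in> commutator_subgroup G A B"
    unfolding commutator_subgroup_def commutator_def using assms by (auto intro: generate.incl)
  moreover have "\<one> \<in> lie_subgroup G A B"
    unfolding lie_subgroup_def by (rule generate.one)
  moreover have "commutator G a b = \<one> \<otimes> commutator G a b"
    using assms by (auto simp: subset_iff)
  ultimately show ?thesis unfolding M_bracket_def set_mult_def by blast
qed

text \<open>Replaces induction over generators. Later arguments take for \<open>S\<close> the
  elements with a desired property and check only that these form a subgroup containing both kinds
  of generators.\<close>

lemma M_bracket_minimal:
  assumes S: "subgroup S G"
    and "\<And>a b. a \<in> A \<Longrightarrow> b \<in> B \<Longrightarrow> a \<star> b \<in> S"
    and "\<And>a b. a \<in> A \<Longrightarrow> b \<in> B \<Longrightarrow> commutator G a b \<in> S"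
  shows "M_bracket G A B \<subseteq> S"
proof -
  have "lie_subgroup G A B \<subseteq> S"
    unfolding lie_subgroup_def using assms by (intro generate_subgroup_incl) auto
  moreover have "commutator_subgroup G A B \<subseteq> S"
    unfolding commutator_subgroup_def commutator_def[symmetric]
    using assms by (intro generate_subgroup_incl) auto
  ultimately show ?thesis
    using subgroup.m_closed[OF S] by (auto simp: M_bracket_def set_mult_def)
qed

text \<open>The inclusion in \<open>R\<close> comes first and yields absorption: an element
  \<open>y\<close> of the bracket lies in \<open>R\<close>, so \<open>y \<star> x\<close> is itself
  a generator, and \<open>x \<star> y\<close> is its inverse.\<close>

lemma M_bracket_ideal:
  assumes R: "mla_ideal G R"
  shows "mla_ideal G (M_bracket G R (carrier G))" "M_bracket G R (carrier G) \<subseteq> R"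
proof -
  have N: "R \<lhd> G" and sub: "subgroup R G"
    using R by (auto simp: mla_ideal_def normal_imp_subgroup)
  have inv: "conj_invariant G R" "conj_invariant G (carrier G)"
    by (simp_all add: conj_invariant_normal N conj_invariant_carrier)
  have Rc: "R \<subseteq> carrier G" by (rule subgroup.subset[OF sub])
  show MR: "M_bracket G R (carrier G) \<subseteq> R"
  proof (rule M_bracket_minimal[OF sub])
    fix a b assume a: "a \<in> R" and b: "b \<in> carrier G"
    show "a \<star> b \<in> R" by (rule mla_ideal_left[OF R a b])
    \<comment> \<open>Regrouped as an element of \<open>R\<close> times a conjugate of its inverse,
      so that normality applies.\<close>
    have "commutator G a b = a \<otimes> (b \<otimes> inv a \<otimes> inv b)"
      using a b Rc by (auto simp: commutator_def m_assoc)
    moreover have "b \<otimes> inv a \<otimes> inv b \<in> R"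
      using N a b subgroup.m_inv_closed[OF sub a] by (auto simp: normal_inv_iff)
    ultimately show "commutator G a b \<in> R" using subgroup.m_closed[OF sub] a by simp
  qed
  have sM: "subgroup (M_bracket G R (carrier G)) G" using inv by (rule M_bracket_subgroup)
  show "mla_ideal G (M_bracket G R (carrier G))"
    unfolding mla_ideal_def
  proof (intro conjI ballI)
    fix x y assume x: "x \<in> carrier G" and y: "y \<in> M_bracket G R (carrier G)"
    have yR: "y \<in> R" using y MR by auto
    then have "y \<star> x \<in> M_bracket G R (carrier G)" using x Rc by (intro lie_in_M_bracket) auto
    then have "inv (y \<star> x) \<in> M_bracket G R (carrier G)" by (rule subgroup.m_inv_closed[OF sM])
    then show "x \<star> y \<in> M_bracket G R (carrier G)" using lie_anticomm[OF x, of y] yR Rc by auto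
  qed (rule M_bracket_normal[OF inv])
qed

lemma mult_lie_algebra_subalgebra:
  assumes S: "subgroup S G" and lie: "\<And>x y. x \<in> S \<Longrightarrow> y \<in> S \<Longrightarrow> x \<star> y \<in> S"
  shows "mult_lie_algebra (G\<lparr>carrier := S\<rparr>)"
proof -
  have conj: "conj_by (G\<lparr>carrier := S\<rparr>) x y = conj_by G x y" if "x \<in> S" for x y
    using that S by (simp add: conj_by_def)
  note mem = subgroup.mem_carrier[OF S]
  show ?thesis
    by (rule mult_lie_algebra.intro[OF subgroup_imp_group[OF S]], unfold_locales)
      (simp_all add: conj lie mem lie_self lie_mult_left lie_mult_right lie_jacobi lie_conj)
qed

section \<open>Absorption of central factors\<close>

lemma central_lie:
  assumes "c \<in> mla_center G" "x \<in> carrier G"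
  shows "c \<star> x = \<one>" "x \<star> c = \<one>" "c \<otimes> x = x \<otimes> c" "c \<in> carrier G"
proof -
  show 1: "c \<star> x = \<one>" "c \<otimes> x = x \<otimes> c" "c \<in> carrier G"
    using assms by (auto simp: mla_center_def lie_center_def group_center_def)
  show "x \<star> c = \<one>" using lie_anticomm[of x c] 1 assms by simp
qed

text \<open>The product rules produce only \<open>c \<star> _\<close> and \<open>_ \<star> d\<close>
  as extra terms, and these are trivial. Hence in a central extension a bracket depends only on the
  images of its arguments in the quotient.\<close>

lemma lie_mult_central:
  assumes c: "c \<in> mla_center G" and d: "d \<in> mla_center G" and ab: "a \<in> carrier G" "b \<in> carrier G"
  shows "(a \<otimes> c) \<star> (b \<otimes> d) = a \<star> b"
proof -
  have cd: "c \<in> carrier G" "d \<in> carrier G" using central_lie(4) c d ab by auto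
  have "(a \<otimes> c) \<star> (b \<otimes> d) = a \<star> (b \<otimes> d)"
    using ab cd c by (simp add: lie_mult_left central_lie lie_closed)
      (simp add: conj_by_def)
  also have "\<dots> = a \<star> b"
    using ab cd d by (simp add: lie_mult_right central_lie lie_closed) (simp add: conj_by_def lie_closed)
  finally show ?thesis .
qed

lemma commutator_mult_center:
  assumes c: "c \<in> mla_center G" and d: "d \<in> mla_center G" and ab: "a \<in> carrier G" "b \<in> carrier G"
  shows "commutator G (a \<otimes> c) (b \<otimes> d) = commutator G a b"
  using ab central_lie(4)[OF c ab(1)] central_lie(4)[OF d ab(1)] central_lie(3)[OF c]
    central_lie(3)[OF d]
  by (rule commutator_mult_central)

end

section \<open>Homomorphisms and quotients\<close>

lemma mla_hom_group_hom:
  "h \<in> mla_hom G H \<Longrightarrow> mult_lie_algebra G \<Longrightarrow> mult_lie_algebra H \<Longrightarrow> group_hom G H h"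
  by (simp add: mla_hom_def group_hom_def group_hom_axioms_def mult_lie_algebra_def)

lemma hom_commutator:
  assumes "h \<in> mla_hom G H" "mult_lie_algebra G" "mult_lie_algebra H"
    and "x \<in> carrier G" "y \<in> carrier G"
  shows "h (commutator G x y) = commutator H (h x) (h y)"
proof -
  interpret group_hom G H h using assms(1-3) by (rule mla_hom_group_hom)
  show ?thesis using assms(4,5) by (simp add: commutator_def)
qed

text \<open>Minimality of the bracket, applied to the preimage of \<open>S\<close>. It serves both
  to map brackets to brackets and, with \<open>S\<close> trivial, to show that a bracket is
  killed.\<close>

lemma M_bracket_image_subset:
  assumes h: "h \<in> mla_hom G H" and G: "mult_lie_algebra G" and H: "mult_lie_algebra H"
    and AB: "A \<subseteq> carrier G" "B \<subseteq> carrier G" and S: "subgroup S H"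
    and lie: "\<And>a b. a \<in> A \<Longrightarrow> b \<in> B \<Longrightarrow> h a \<star>\<^bsub>H\<^esub> h b \<in> S"
    and comm: "\<And>a b. a \<in> A \<Longrightarrow> b \<in> B \<Longrightarrow> commutator H (h a) (h b) \<in> S"
  shows "h ` M_bracket G A B \<subseteq> S"
proof -
  interpret G: mla G using G by (rule mla.intro)
  interpret group_hom G H h using h G H by (rule mla_hom_group_hom)
  have "subgroup {x \<in> carrier G. h x \<in> S} G"
    using S by (auto intro!: G.subgroupI simp: subgroup.m_closed subgroup.m_inv_closed
        subgroup.one_closed intro: exI[of _ "\<one>\<^bsub>G\<^esub>"])
  then have "M_bracket G A B \<subseteq> {x \<in> carrier G. h x \<in> S}"
  proof (rule G.M_bracket_minimal)
    fix a b assume ab: "a \<in> A" "b \<in> B"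
    then have c: "a \<in> carrier G" "b \<in> carrier G" using AB by auto
    show "a \<star>\<^bsub>G\<^esub> b \<in> {x \<in> carrier G. h x \<in> S}"
      using lie[OF ab] c G.lie_closed mla_hom_simps(2)[OF h c] by simp
    show "commutator G a b \<in> {x \<in> carrier G. h x \<in> S}"
      using comm[OF ab] c hom_commutator[OF h G H c] by simp
  qed
  then show ?thesis by auto
qed

lemma M_bracket_hom:
  assumes h: "h \<in> mla_hom G H" and G: "mult_lie_algebra G" and H: "mult_lie_algebra H"
  shows "h ` M_bracket G (carrier G) (carrier G) \<subseteq> M_bracket H (carrier H) (carrier H)"
proof -
  interpret H: mla H using H by (rule mla.intro)
  show ?thesis
    using h mla_hom_simps(3)[OF h]
    by (intro M_bracket_image_subset[OF h G H] H.M_bracket_subgroup H.conj_invariant_carrier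
        H.lie_in_M_bracket H.commutator_in_M_bracket) auto
qed

text \<open>For the inclusion not given by \<open>M_bracket_hom\<close>, arguments of generators in
  \<open>H\<close> lift along the surjection, and the image of the bracket is a subgroup.\<close>

lemma M_bracket_surj_hom:
  assumes h: "h \<in> mla_hom G H" and G: "mult_lie_algebra G" and H: "mult_lie_algebra H"
    and surj: "h ` carrier G = carrier H"
  shows "h ` M_bracket G (carrier G) (carrier G) = M_bracket H (carrier H) (carrier H)"
proof
  interpret G: mla G using G by (rule mla.intro)
  interpret H: mla H using H by (rule mla.intro)
  interpret group_hom G H h using h G H by (rule mla_hom_group_hom)
  let ?G' = "M_bracket G (carrier G) (carrier G)"
  show "M_bracket H (carrier H) (carrier H) \<subseteq> h ` ?G'"
  proof (rule H.M_bracket_minimal)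
    show "subgroup (h ` ?G') H"
      by (intro subgroup_img_is_subgroup G.M_bracket_subgroup G.conj_invariant_carrier)
    fix a b assume "a \<in> carrier H" "b \<in> carrier H"
    then obtain x y where xy: "x \<in> carrier G" "y \<in> carrier G" "a = h x" "b = h y"
      unfolding surj[symmetric] by auto
    show "a \<star>\<^bsub>H\<^esub> b \<in> h ` ?G'"
      unfolding xy(3,4) mla_hom_simps(2)[OF h xy(1,2), symmetric]
      by (intro imageI G.lie_in_M_bracket xy subset_refl)
    show "commutator H a b \<in> h ` ?G'"
      unfolding xy(3,4) hom_commutator[OF h G H xy(1,2), symmetric]
      by (intro imageI G.commutator_in_M_bracket xy subset_refl)
  qed
qed (rule M_bracket_hom[OF h G H])

lemma kernel_ideal:
  assumes h: "h \<in> mla_hom G H" and G: "mult_lie_algebra G" and H: "mult_lie_algebra H"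
  shows "mla_ideal G (kernel G H h)"
proof -
  interpret G: mla G using G by (rule mla.intro)
  interpret H: mla H using H by (rule mla.intro)
  interpret group_hom G H h using h G H by (rule mla_hom_group_hom)
  show ?thesis
    using normal_kernel mla_hom_simps(2)[OF h] G.lie_closed H.lie_one_right
    by (auto simp: mla_ideal_def kernel_def)
qed

text \<open>Identities pass to surjective images. This spares checking the axioms on cosets, once
  the quotient is known to be a group and the projection to respect \<open>\<star>\<close>.\<close>

lemma mult_lie_algebra_surj_image:
  assumes G: "mult_lie_algebra G" and H: "group H" and h: "h \<in> mla_hom G H"
    and surj: "h ` carrier G = carrier H"
  shows "mult_lie_algebra H"
proof -
  interpret G: mult_lie_algebra G by (rule G)
  interpret H: group H by (rule H)
  interpret group_hom G H h
    using h G H by (simp add: mla_hom_def group_hom_def group_hom_axioms_def G.group_axioms)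
  have lie: "h x \<star>\<^bsub>H\<^esub> h y = h (x \<star>\<^bsub>G\<^esub> y)" if "x \<in> carrier G" "y \<in> carrier G" for x y
    using mla_hom_simps(2)[OF h that] by simp
  have conj: "conj_by H (h x) (h y) = h (conj_by G x y)" if "x \<in> carrier G" "y \<in> carrier G" for x y
    using that by (simp add: conj_by_def)
  have mult: "h x \<otimes>\<^bsub>H\<^esub> h y = h (x \<otimes>\<^bsub>G\<^esub> y)" if "x \<in> carrier G" "y \<in> carrier G" for x y
    using that by simp
  note simps = lie conj mult G.lie_closed
  have rep: "\<exists>x\<in>carrier G. a = h x" if "a \<in> carrier H" for a using surj that by blast
  show ?thesis
  proof (rule mult_lie_algebra.intro[OF H], unfold_locales)
    fix a b assume "a \<in> carrier H" "b \<in> carrier H"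
    then show "a \<star>\<^bsub>H\<^esub> b \<in> carrier H" using rep by (metis simps(1) G.lie_closed hom_closed)
  next
    fix a assume "a \<in> carrier H"
    then show "a \<star>\<^bsub>H\<^esub> a = \<one>\<^bsub>H\<^esub>" using rep by (metis lie G.lie_self hom_one)
  next
    fix a b c assume "a \<in> carrier H" "b \<in> carrier H" "c \<in> carrier H"
    then obtain x y z where xyz: "x \<in> carrier G" "y \<in> carrier G" "z \<in> carrier G"
      "a = h x" "b = h y" "c = h z" using rep by meson
    then show "a \<star>\<^bsub>H\<^esub> (b \<otimes>\<^bsub>H\<^esub> c) = (a \<star>\<^bsub>H\<^esub> b) \<otimes>\<^bsub>H\<^esub> conj_by H b (a \<star>\<^bsub>H\<^esub> c)"
      by (simp add: simps G.lie_mult_right del: hom_mult)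
    show "(a \<otimes>\<^bsub>H\<^esub> b) \<star>\<^bsub>H\<^esub> c = conj_by H a (b \<star>\<^bsub>H\<^esub> c) \<otimes>\<^bsub>H\<^esub> (a \<star>\<^bsub>H\<^esub> c)"
      using xyz by (simp add: simps G.lie_mult_left del: hom_mult)
    show "((a \<star>\<^bsub>H\<^esub> b) \<star>\<^bsub>H\<^esub> conj_by H b c) \<otimes>\<^bsub>H\<^esub> ((b \<star>\<^bsub>H\<^esub> c) \<star>\<^bsub>H\<^esub> conj_by H c a)
        \<otimes>\<^bsub>H\<^esub> ((c \<star>\<^bsub>H\<^esub> a) \<star>\<^bsub>H\<^esub> conj_by H a b) = \<one>\<^bsub>H\<^esub>"
      using xyz by (simp add: simps G.lie_jacobi del: hom_mult)
    show "conj_by H c (a \<star>\<^bsub>H\<^esub> b) = conj_by H c a \<star>\<^bsub>H\<^esub> conj_by H c b"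
      using xyz by (simp add: simps G.lie_conj del: hom_mult)
  qed
qed

section \<open>Quotients by an ideal\<close>

lemma mla_quotient_simps [simp]:
  "carrier (mla_quotient G H) = rcosets\<^bsub>G\<^esub> H"
  "mult (mla_quotient G H) = set_mult G"
  "one (mla_quotient G H) = H"
  "A \<star>\<^bsub>mla_quotient G H\<^esub> B = (\<Union>a\<in>A. \<Union>b\<in>B. H #>\<^bsub>G\<^esub> (a \<star>\<^bsub>G\<^esub> b))"
  by (simp_all add: mla_quotient_def)

text \<open>The coset operations look only at \<open>mult\<close> and \<open>lie\<close>, never at
  the carrier, so this is an equality of records for arbitrary sets. It places quotients of
  subalgebras of \<open>F\<close> inside the corresponding quotient of \<open>F\<close>.\<close>

lemma mla_quotient_restrict:
  "mla_quotient (G\<lparr>carrier := S\<rparr>) H = (mla_quotient G H)\<lparr>carrier := (\<lambda>x. H #>\<^bsub>G\<^esub> x) ` S\<rparr>"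
  by (auto simp: mla_quotient_def RCOSETS_def r_coset_def set_mult_def fun_eq_iff)

text \<open>Transfers the group structure of \<open>G Mod H\<close> to
  \<open>mla_quotient G H\<close>, a record of a different type with the same carrier, product and
  unit.\<close>

lemma (in group) group_cong_group:
  assumes "carrier H = carrier G" "mult H = mult G" "one H = one G"
  shows "group H"
proof (rule groupI)
  show "\<exists>y\<in>carrier H. y \<otimes>\<^bsub>H\<^esub> x = \<one>\<^bsub>H\<^esub>" if "x \<in> carrier H" for x
    using assms that l_inv_ex[of x] by (simp add: Bex_def)
qed (use assms in \<open>auto simp: m_assoc\<close>)

context mla
begin

context
  fixes H assumes ideal: "mla_ideal G H"
begin

interpretation H: normal H G using ideal by (simp add: mla_ideal_def)

text \<open>The operation on cosets is well defined: in the expansion of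
  \<open>(u \<otimes> x) \<star> (v \<otimes> y)\<close> the terms involving \<open>u\<close> or
  \<open>v\<close> as an argument of \<open>\<star>\<close> lie in \<open>H\<close>, and conjugation
  by elements of \<open>H\<close> is trivial modulo \<open>H\<close>.\<close>

lemma rcos_lie:
  assumes x: "x \<in> carrier G" and y: "y \<in> carrier G"
  shows "(\<Union>a\<in>H #> x. \<Union>b\<in>H #> y. H #> (a \<star> b)) = H #> (x \<star> y)"
proof -
  have "H #> (a \<star> b) = H #> (x \<star> y)" if ab: "a \<in> H #> x" "b \<in> H #> y" for a b
  proof -
    obtain u v where uv: "u \<in> H" "v \<in> H" "a = u \<otimes> x" "b = v \<otimes> y"
      using ab by (auto simp: r_coset_def)
    have c: "u \<in> carrier G" "v \<in> carrier G" using uv by auto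
    have cong: "H #> (s \<otimes> t) = H #> t" "H #> (t \<otimes> s) = H #> t"
      if s: "s \<in> H" and t: "t \<in> carrier G" for s t
    proof -
      have sc: "s \<in> carrier G" using s by auto
      have "H #> s = H" using sc H.subgroup_axioms s by (rule coset_join2)
      then have eq: "H #> s = H #> \<one>" by (simp add: H.subset)
      show "H #> (s \<otimes> t) = H #> t"
        unfolding H.rcos_sum[OF sc t, symmetric] eq H.rcos_sum[OF one_closed t] using t by simp
      show "H #> (t \<otimes> s) = H #> t"
        unfolding H.rcos_sum[OF t sc, symmetric] eq H.rcos_sum[OF t one_closed] using t by simp
    qed
    have ul: "u \<star> t \<in> H" if "t \<in> carrier G" for t using mla_ideal_left[OF ideal uv(1) that] .
    have vr: "t \<star> v \<in> H" if "t \<in> carrier G" for t using ideal uv that by (auto simp: mla_ideal_def)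
    have conj: "H #> conj_by G s t = H #> t" if s: "s \<in> H" and t: "t \<in> carrier G" for s t
    proof -
      have "s \<in> carrier G" using s by auto
      then show ?thesis
        using cong(2)[of "inv s" "s \<otimes> t"] cong(1)[OF s t] s t by (simp add: conj_by_def)
    qed
    have "a \<star> b = conj_by G u (x \<star> b) \<otimes> (u \<star> b)"
      unfolding uv using c x y by (simp add: lie_mult_left)
    then have "H #> (a \<star> b) = H #> (x \<star> b)"
      using c x y uv by (simp add: cong(2) ul conj lie_closed)
    also have "x \<star> b = (x \<star> v) \<otimes> conj_by G v (x \<star> y)"
      unfolding uv using c x y by (simp add: lie_mult_right)
    finally show ?thesis
      using c x y uv by (simp add: cong(1) vr conj lie_closed)
  qed
  moreover have "x \<in> H #> x" "y \<in> H #> y"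
    using x y by (simp_all add: rcos_self H.subgroup_axioms)
  ultimately show ?thesis by blast
qed

lemma mult_lie_algebra_quotient: "mult_lie_algebra (mla_quotient G H)"
  and quotient_map_hom: "(\<lambda>x. H #> x) \<in> mla_hom G (mla_quotient G H)"
  and quotient_map_surj: "(\<lambda>x. H #> x) ` carrier G = carrier (mla_quotient G H)"
proof -
  interpret FG: group "G Mod H" by (rule H.factorgroup_is_group)
  have grp: "group (mla_quotient G H)"
    by (rule FG.group_cong_group) (simp_all add: FactGroup_def)
  show hom: "(\<lambda>x. H #> x) \<in> mla_hom G (mla_quotient G H)"
    by (auto simp: mla_hom_def hom_def RCOSETS_def H.rcos_sum rcos_lie)
  show surj: "(\<lambda>x. H #> x) ` carrier G = carrier (mla_quotient G H)"
    by (auto simp: RCOSETS_def)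
  show "mult_lie_algebra (mla_quotient G H)"
    by (rule mult_lie_algebra_surj_image[OF mult_lie_algebra_axioms grp hom surj])
qed

lemma quotient_map_factor:
  assumes K: "mult_lie_algebra K" and h: "h \<in> mla_hom G K" and ker: "\<And>x. x \<in> H \<Longrightarrow> h x = \<one>\<^bsub>K\<^esub>"
  shows "\<exists>k\<in>mla_hom (mla_quotient G H) K. \<forall>x\<in>carrier G. k (H #> x) = h x"
proof -
  interpret K: mult_lie_algebra K by (rule K)
  interpret h: group_hom G K h using h mult_lie_algebra_axioms K by (rule mla_hom_group_hom)
  \<comment> \<open>An arbitrary representative will do: two of them differ by a factor in
    \<open>H\<close>, which \<open>h\<close> sends to the unit.\<close>
  define k where "k C = h (SOME x. x \<in> C)" for C
  have k: "k (H #> x) = h x" if x: "x \<in> carrier G" for x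
  proof -
    have "(SOME y. y \<in> H #> x) \<in> H #> x"
      using rcos_self[OF x H.subgroup_axioms] by (rule someI)
    then obtain u where "u \<in> H" "(SOME y. y \<in> H #> x) = u \<otimes> x" by (auto simp: r_coset_def)
    then show ?thesis using x by (simp add: k_def ker)
  qed
  have "k \<in> mla_hom (mla_quotient G H) K"
    by (auto simp: mla_hom_def hom_def RCOSETS_def H.rcos_sum rcos_lie k lie_closed
        mla_hom_simps(2)[OF h])
  then show ?thesis using k by blast
qed

end

end


section \<open>Central extensions\<close>

lemma short_exactD:
  assumes "short_exact N K p G"
  shows "mult_lie_algebra K" "mult_lie_algebra G" "p \<in> mla_hom K G" "p ` carrier K = carrier G"
    "N = kernel K G p"
  using assms by (auto simp: short_exact_def)

text \<open>The quotient of two elements with the same image lies in the kernel, which is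
  central.\<close>

lemma same_fibre_mult_central:
  assumes ext: "central_extension N K p G" and x: "x \<in> carrier K" and y: "y \<in> carrier K"
    and eq: "p x = p y"
  shows "\<exists>c\<in>mla_center K. y = x \<otimes>\<^bsub>K\<^esub> c"
proof
  have se: "short_exact N K p G" and N: "N \<subseteq> mla_center K"
    using ext by (auto simp: central_extension_def)
  note se = short_exactD[OF se]
  interpret group_hom K G p using se(3,1,2) by (rule mla_hom_group_hom)
  show "inv\<^bsub>K\<^esub> x \<otimes>\<^bsub>K\<^esub> y \<in> mla_center K"
    using N x y eq unfolding se(5) kernel_def by auto
  show "y = x \<otimes>\<^bsub>K\<^esub> (inv\<^bsub>K\<^esub> x \<otimes>\<^bsub>K\<^esub> y)" using x y by (simp flip: G.m_assoc)
qed

text \<open>Such an \<open>h\<close> changes elements by central factors only, so it fixes every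
  \<open>\<star>\<close>-product and commutator; its fixed points form a subgroup.\<close>

lemma central_extension_endo_fixes_M_bracket:
  assumes ext: "central_extension N K p G" and h: "h \<in> mla_hom K K"
    and over: "\<And>x. x \<in> carrier K \<Longrightarrow> p (h x) = p x"
    and x: "x \<in> M_bracket K (carrier K) (carrier K)"
  shows "h x = x"
proof -
  have K: "mult_lie_algebra K" using ext by (auto simp: central_extension_def short_exact_def)
  interpret K: mla K using K by (rule mla.intro)
  interpret group_hom K K h using h K K by (rule mla_hom_group_hom)
  have central: "\<exists>c\<in>mla_center K. h a = a \<otimes>\<^bsub>K\<^esub> c" if "a \<in> carrier K" for a
    using same_fibre_mult_central[OF ext that, of "h a"] over that by simp
  have "subgroup {x \<in> carrier K. h x = x} K"
    by (auto intro!: K.subgroupI intro: exI[of _ "\<one>\<^bsub>K\<^esub>"])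
  then have "M_bracket K (carrier K) (carrier K) \<subseteq> {x \<in> carrier K. h x = x}"
  proof (rule K.M_bracket_minimal)
    fix a b assume ab: "a \<in> carrier K" "b \<in> carrier K"
    obtain c d where cd: "c \<in> mla_center K" "d \<in> mla_center K"
      "h a = a \<otimes>\<^bsub>K\<^esub> c" "h b = b \<otimes>\<^bsub>K\<^esub> d"
      using central ab by meson
    show "a \<star>\<^bsub>K\<^esub> b \<in> {x \<in> carrier K. h x = x}"
      using mla_hom_simps(2)[OF h ab] cd ab by (simp add: K.lie_mult_central K.lie_closed)
    have "commutator K (a \<otimes>\<^bsub>K\<^esub> c) (b \<otimes>\<^bsub>K\<^esub> d) = commutator K a b"
      using cd(1,2) ab by (rule K.commutator_mult_center)
    then show "commutator K a b \<in> {x \<in> carrier K. h x = x}"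
      using hom_commutator[OF h K K ab] cd ab by simp
  qed
  then show ?thesis using x by auto
qed

text \<open>Passing to \<open>K'\<close> keeps the map onto \<open>G\<close> because
  \<open>G\<close> is perfect, and then every element of \<open>K\<close> is one of
  \<open>K'\<close> up to a central factor, so brackets over \<open>K\<close> and over
  \<open>K'\<close> agree.\<close>

lemma stem_extension_M_bracket:
  assumes ext: "central_extension N K p G" and perf: "mla_perfect G"
  defines "K' \<equiv> M_bracket K (carrier K) (carrier K)"
  shows "stem_extension (K' \<inter> N) (K\<lparr>carrier := K'\<rparr>) p G"
proof -
  have "short_exact N K p G" and N: "N \<subseteq> mla_center K"
    using ext by (auto simp: central_extension_def)
  note se = short_exactD[OF this(1)]
  interpret K: mla K using se(1) by (rule mla.intro)
  interpret group_hom K G p using se(3,1,2) by (rule mla_hom_group_hom)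
  have sub: "subgroup K' K"
    unfolding K'_def by (intro K.M_bracket_subgroup K.conj_invariant_carrier)
  note mem = subgroup.mem_carrier[OF sub]
  let ?L = "K\<lparr>carrier := K'\<rparr>"
  have L: "mult_lie_algebra ?L"
    using sub by (rule K.mult_lie_algebra_subalgebra)
      (auto simp: K'_def mem[unfolded K'_def] intro!: K.lie_in_M_bracket)
  interpret L: mla ?L using L by (rule mla.intro)
  \<comment> \<open>Perfectness enters here: the image of the bracket of \<open>K\<close> is the
    bracket of \<open>G\<close>.\<close>
  have im: "p ` K' = carrier G"
    using M_bracket_surj_hom[OF se(3,1,2,4)] perf by (simp add: K'_def mla_perfect_def)
  have hom: "p \<in> mla_hom ?L G"
    using se(3) mem by (auto simp: mla_hom_def hom_def)
  have short: "short_exact (K' \<inter> N) ?L p G"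
    unfolding short_exact_def
    using L se(2) hom im by (auto simp: se(5) kernel_def mem)
  have "K' \<inter> N \<subseteq> mla_center ?L"
    using N mem by (auto simp: mla_center_def lie_center_def group_center_def)
  \<comment> \<open>This gives the stem condition in a stronger form: the whole of
    \<open>K'\<close>, not just the kernel, lies in its own bracket.\<close>
  moreover have "K' \<subseteq> M_bracket ?L K' K'"
  proof -
    have subL: "subgroup (M_bracket ?L K' K') ?L"
      using L.M_bracket_subgroup[OF L.conj_invariant_carrier L.conj_invariant_carrier] by simp
    have "M_bracket K (carrier K) (carrier K) \<subseteq> M_bracket ?L K' K'"
    proof (rule K.M_bracket_minimal)
      show "subgroup (M_bracket ?L K' K') K" using sub subL by (rule K.incl_subgroup)
      fix a b assume ab: "a \<in> carrier K" "b \<in> carrier K"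
      have rep: "\<exists>a'\<in>K'. \<exists>c\<in>mla_center K. a = a' \<otimes>\<^bsub>K\<^esub> c" if a: "a \<in> carrier K" for a
      proof -
        have "p a \<in> p ` K'" using im a by simp
        then obtain a' where "a' \<in> K'" "p a' = p a" by auto
        then show ?thesis using same_fibre_mult_central[OF ext mem a] by blast
      qed
      obtain a' b' c d where abcd: "a' \<in> K'" "b' \<in> K'" "c \<in> mla_center K" "d \<in> mla_center K"
        "a = a' \<otimes>\<^bsub>K\<^esub> c" "b = b' \<otimes>\<^bsub>K\<^esub> d"
        using rep[OF ab(1)] rep[OF ab(2)] by blast
      have "a \<star>\<^bsub>K\<^esub> b = a' \<star>\<^bsub>K\<^esub> b'"
        using abcd mem by (simp add: K.lie_mult_central)
      also have "\<dots> \<in> M_bracket ?L K' K'"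
        using L.lie_in_M_bracket[of a' K' b' K'] abcd by simp
      finally show "a \<star>\<^bsub>K\<^esub> b \<in> M_bracket ?L K' K'" .
      have "commutator K a b = commutator K a' b'"
        unfolding abcd(5,6)
        using abcd(3,4) mem[OF abcd(1)] mem[OF abcd(2)] by (rule K.commutator_mult_center)
      also have "\<dots> = commutator ?L a' b'"
        using abcd(1,2) sub by (simp add: commutator_def)
      also have "\<dots> \<in> M_bracket ?L K' K'"
        using L.commutator_in_M_bracket[of a' K' b' K'] abcd by simp
      finally show "commutator K a b \<in> M_bracket ?L K' K'" .
    qed
    then show ?thesis by (simp add: K'_def)
  qed
  ultimately show ?thesis
    using short by (auto simp: stem_extension_def central_extension_def)
qed

section \<open>Free presentations\<close>

text \<open>Free algebras are projective: preimages of the values of \<open>f\<close> on the basis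
  are chosen and extended to \<open>F\<close>.\<close>

lemma free_on_lift:
  fixes F :: "'f mult_lie" and K :: "'k mult_lie" and G :: "'g mult_lie"
  assumes free: "free_on F X" and f: "f \<in> mla_hom F G" and K: "mult_lie_algebra K"
    and G: "mult_lie_algebra G" and p: "p \<in> mla_hom K G" and surj: "p ` carrier K = carrier G"
  shows "\<exists>h\<in>mla_hom F K. \<forall>x\<in>carrier F. p (h x) = f x"
proof -
  have X: "X \<subseteq> carrier F" using free by (simp add: free_on_def)
  have "\<forall>x\<in>X. \<exists>k\<in>carrier K. p k = f x"
    using mla_hom_simps(3)[OF f] X surj by (metis imageE subsetD)
  then obtain s where s: "\<And>x. x \<in> X \<Longrightarrow> s x \<in> carrier K" "\<And>x. x \<in> X \<Longrightarrow> p (s x) = f x"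
    by metis
  have "s \<in> X \<rightarrow> carrier K" using s by auto
  with free_on_universal[OF free, where 'c = 'k] K
  obtain h where h: "h \<in> mla_hom F K" "\<And>x. x \<in> X \<Longrightarrow> h x = s x"
    unfolding universal_on_def by metis
  \<comment> \<open>Universality is used a second time, now for its uniqueness part with target
    \<open>G\<close>: both \<open>p \<circ> h\<close> and \<open>f\<close> extend \<open>f\<close>
    from the basis, so both equal \<open>g\<close>.\<close>
  have "f \<in> X \<rightarrow> carrier G" using mla_hom_simps(3)[OF f] X by auto
  with free_on_universal[OF free, where 'c = 'g] G
  obtain g where g: "\<And>h'. h' \<in> mla_hom F G \<Longrightarrow> \<forall>x\<in>X. h' x = f x \<Longrightarrow> \<forall>u\<in>carrier F. h' u = g u"
    unfolding universal_on_def by metis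
  have "\<forall>u\<in>carrier F. (p \<circ> h) u = g u"
    using h s by (intro g mla_hom_comp[OF h(1) p]) simp
  moreover have "\<forall>u\<in>carrier F. f u = g u" using f by (intro g) simp_all
  ultimately show ?thesis using h(1) by auto
qed

text \<open>Dividing by the bracket of \<open>R\<close> with \<open>F\<close> is what makes
  \<open>R\<close> central: it kills all products \<open>r \<star> x\<close> and all commutators of
  \<open>r\<close> with \<open>x\<close>. The projection still factors, since the bracket lies in
  \<open>R\<close>.\<close>

lemma free_presentation_central_extension:
  fixes F :: "'f mult_lie" and G :: "'g mult_lie"
  assumes pres: "free_presentation R F \<pi> G"
  defines "M \<equiv> M_bracket F R (carrier F)" and "q \<equiv> \<lambda>x. M_bracket F R (carrier F) #>\<^bsub>F\<^esub> x"
  shows "\<exists>p. central_extension (q ` R) (mla_quotient F M) p G \<and> (\<forall>x\<in>carrier F. p (q x) = \<pi> x)"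
proof -
  have "short_exact R F \<pi> G" using pres by (simp add: free_presentation_def)
  note se = short_exactD[OF this]
  interpret F: mla F using se(1) by (rule mla.intro)
  have R: "mla_ideal F R" unfolding se(5) by (rule kernel_ideal[OF se(3,1,2)])
  have Rc: "R \<subseteq> carrier F" by (auto simp: se(5) kernel_def)
  have M: "mla_ideal F M" "M \<subseteq> R" unfolding M_def by (rule F.M_bracket_ideal[OF R])+
  have subM: "subgroup M F" using M(1) by (simp add: mla_ideal_def normal_imp_subgroup)
  let ?Q = "mla_quotient F M"
  have Q: "mult_lie_algebra ?Q" by (rule F.mult_lie_algebra_quotient[OF M(1)])
  interpret Q: mla ?Q using Q by (rule mla.intro)
  have q: "q \<in> mla_hom F ?Q" "q ` carrier F = carrier ?Q"
    using F.quotient_map_hom[OF M(1)] F.quotient_map_surj[OF M(1)] by (simp_all add: q_def M_def)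
  have q1: "q x = \<one>\<^bsub>?Q\<^esub>" if "x \<in> M" for x
    using that F.coset_join2[OF _ subM that] subgroup.mem_carrier[OF subM that]
    by (simp add: q_def M_def)
  have "\<pi> x = \<one>\<^bsub>G\<^esub>" if "x \<in> M" for x using that M(2) by (auto simp: se(5) kernel_def)
  then obtain p where p: "p \<in> mla_hom ?Q G" "\<And>x. x \<in> carrier F \<Longrightarrow> p (q x) = \<pi> x"
    using F.quotient_map_factor[OF M(1) se(2,3)] by (auto simp: q_def M_def)
  have "p ` carrier ?Q = carrier G"
    unfolding q(2)[symmetric] se(4)[symmetric] using p(2) by (simp add: image_image)
  moreover have "q ` R = kernel ?Q G p"
    unfolding kernel_def q(2)[symmetric] using p(2) by (auto simp: se(5) kernel_def)
  moreover have "q ` R \<subseteq> mla_center ?Q"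
  proof (rule image_subsetI)
    fix r assume r: "r \<in> R"
    then have rc: "r \<in> carrier F" using Rc by auto
    have "q r \<star>\<^bsub>?Q\<^esub> q x = \<one>\<^bsub>?Q\<^esub> \<and> commutator ?Q (q r) (q x) = \<one>\<^bsub>?Q\<^esub>" if x: "x \<in> carrier F" for x
    proof -
      have "r \<star>\<^bsub>F\<^esub> x \<in> M" "commutator F r x \<in> M"
        unfolding M_def using r x Rc by (auto intro!: F.lie_in_M_bracket F.commutator_in_M_bracket)
      then show ?thesis
        using q1 mla_hom_simps(2)[OF q(1) rc x] hom_commutator[OF q(1) se(1) Q rc x] by metis
    qed
    moreover have "q r \<in> carrier ?Q" using mla_hom_simps(3)[OF q(1) rc rc] .
    ultimately show "q r \<in> mla_center ?Q"
      unfolding mla_center_def lie_center_def group_center_def q(2)[symmetric]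
      using Q.commutator_eq_one_iff mla_hom_simps(3)[OF q(1)]
      by (simp only: Int_iff mem_Collect_eq ball_simps) (simp add: q(2))
  qed
  ultimately show ?thesis
    using Q se(2) p unfolding central_extension_def short_exact_def by blast
qed

text \<open>A lift of \<open>\<pi>\<close> to \<open>K\<close> exists by freeness. It sends
  \<open>R\<close> into the central kernel \<open>N\<close>, hence kills the generators of
  \<open>M\<close> and descends to the quotient.\<close>

lemma free_presentation_lift_central:
  fixes F :: "'f mult_lie" and K :: "'k mult_lie" and G :: "'g mult_lie"
  assumes pres: "free_presentation R F \<pi> G" and ext: "central_extension N K p G"
  defines "M \<equiv> M_bracket F R (carrier F)"
  shows "\<exists>k\<in>mla_hom (mla_quotient F M) K. \<forall>x\<in>carrier F. p (k (M #>\<^bsub>F\<^esub> x)) = \<pi> x"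
proof -
  have "short_exact R F \<pi> G" using pres by (simp add: free_presentation_def)
  note se = short_exactD[OF this]
  have "short_exact N K p G" and N: "N \<subseteq> mla_center K"
    using ext by (auto simp: central_extension_def)
  note seK = short_exactD[OF this(1)]
  interpret F: mla F using se(1) by (rule mla.intro)
  interpret K: mla K using seK(1) by (rule mla.intro)
  have R: "mla_ideal F R" unfolding se(5) by (rule kernel_ideal[OF se(3,1,2)])
  have Rc: "R \<subseteq> carrier F" by (auto simp: se(5) kernel_def)
  obtain h where h: "h \<in> mla_hom F K" "\<And>x. x \<in> carrier F \<Longrightarrow> p (h x) = \<pi> x"
    using pres free_on_lift[OF _ se(3) seK(1,2,3,4)] unfolding free_presentation_def by blast
  have "h ` M \<subseteq> {\<one>\<^bsub>K\<^esub>}"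
    unfolding M_def
  proof (rule M_bracket_image_subset[OF h(1) se(1) seK(1) Rc subset_refl])
    fix r x assume r: "r \<in> R" and x: "x \<in> carrier F"
    have "h r \<in> N"
      using r h mla_hom_simps(3)[OF h(1)] unfolding se(5) seK(5) kernel_def by auto
    then have c: "h r \<in> mla_center K" using N by auto
    have hx: "h x \<in> carrier K" using mla_hom_simps(3)[OF h(1) x x] .
    show "h r \<star>\<^bsub>K\<^esub> h x \<in> {\<one>\<^bsub>K\<^esub>}" "commutator K (h r) (h x) \<in> {\<one>\<^bsub>K\<^esub>}"
      using K.central_lie[OF c hx] hx by (simp_all add: K.commutator_eq_one_iff)
  qed (rule K.triv_subgroup)
  then obtain k where "k \<in> mla_hom (mla_quotient F M) K" "\<forall>x\<in>carrier F. k (M #>\<^bsub>F\<^esub> x) = h x"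
    using F.quotient_map_factor[OF _ seK(1) h(1), of M] F.M_bracket_ideal(1)[OF R]
    by (auto simp: M_def)
  then show ?thesis using h(2) by (intro bexI[of _ k]) auto
qed

text \<open>Both composites of \<open>f\<close> and \<open>g\<close> are endomorphisms over
  \<open>G\<close>, so they fix the brackets pointwise. Thus \<open>f\<close> and \<open>g\<close>
  are mutually inverse there, although they need not be so on all of \<open>K\<close> and
  \<open>K0\<close>.\<close>

lemma mla_isomorphic_M_bracket_kernel:
  assumes ext: "central_extension N K p G" and ext0: "central_extension N0 K0 p0 G"
    and f: "f \<in> mla_hom K K0" "\<And>x. x \<in> carrier K \<Longrightarrow> p0 (f x) = p x"
    and g: "g \<in> mla_hom K0 K" "\<And>x. x \<in> carrier K0 \<Longrightarrow> p (g x) = p0 x"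
  shows "mla_isomorphic (K\<lparr>carrier := M_bracket K (carrier K) (carrier K) \<inter> N\<rparr>)
    (K0\<lparr>carrier := M_bracket K0 (carrier K0) (carrier K0) \<inter> N0\<rparr>)"
proof -
  let ?S = "M_bracket K (carrier K) (carrier K) \<inter> N"
    and ?T = "M_bracket K0 (carrier K0) (carrier K0) \<inter> N0"
  have "short_exact N K p G" "short_exact N0 K0 p0 G"
    using ext ext0 by (auto simp: central_extension_def)
  note se = short_exactD[OF this(1)] and se0 = short_exactD[OF this(2)]
  note ker = se(5) se0(5) kernel_def
  have gf: "g (f x) = x" if "x \<in> ?S" for x
    using central_extension_endo_fixes_M_bracket[OF ext mla_hom_comp[OF f(1) g(1)]] that f g
      mla_hom_simps(3)[OF f(1)] by simp
  have fg: "f (g x) = x" if "x \<in> ?T" for x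
    using central_extension_endo_fixes_M_bracket[OF ext0 mla_hom_comp[OF g(1) f(1)]] that f g
      mla_hom_simps(3)[OF g(1)] by simp
  have fS: "f x \<in> ?T" if "x \<in> ?S" for x
    using that M_bracket_hom[OF f(1) se(1) se0(1)] f mla_hom_simps(3)[OF f(1)]
    by (auto simp: ker)
  have gS: "g x \<in> ?S" if "x \<in> ?T" for x
    using that M_bracket_hom[OF g(1) se0(1) se(1)] g mla_hom_simps(3)[OF g(1)]
    by (auto simp: ker)
  have "f \<in> mla_hom (K\<lparr>carrier := ?S\<rparr>) (K0\<lparr>carrier := ?T\<rparr>)"
    using f(1) fS by (auto simp: mla_hom_def hom_def ker)
  moreover have "bij_betw f ?S ?T"
    using gf fg fS gS by (intro bij_betw_byWitness[where f' = g]) auto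
  ultimately show ?thesis by (auto simp: mla_isomorphic_def)
qed

text \<open>Rewrites the multiplier entirely inside the central extension \<open>Q\<close>, where
  the comparison of extensions applies.\<close>

lemma presentation_multiplier_eq:
  assumes pres: "free_presentation R F \<pi> G"
  defines "Q \<equiv> mla_quotient F (M_bracket F R (carrier F))"
    and "q \<equiv> \<lambda>x. M_bracket F R (carrier F) #>\<^bsub>F\<^esub> x"
  shows "presentation_multiplier F R
      = Q\<lparr>carrier := M_bracket Q (carrier Q) (carrier Q) \<inter> q ` R\<rparr>"
    and "M_bracket Q (carrier Q) (carrier Q) = q ` M_bracket F (carrier F) (carrier F)"
proof -
  have "short_exact R F \<pi> G" using pres by (simp add: free_presentation_def)
  note se = short_exactD[OF this]
  interpret F: mla F using se(1) by (rule mla.intro)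
  have R: "mla_ideal F R" unfolding se(5) by (rule kernel_ideal[OF se(3,1,2)])
  note M = F.M_bracket_ideal(1)[OF R]
  show Q': "M_bracket Q (carrier Q) (carrier Q) = q ` M_bracket F (carrier F) (carrier F)"
    unfolding Q_def q_def
    using M_bracket_surj_hom[OF F.quotient_map_hom[OF M] se(1) F.mult_lie_algebra_quotient[OF M]
        F.quotient_map_surj[OF M]] by simp
  obtain p where p: "\<And>x. x \<in> carrier F \<Longrightarrow> p (q x) = \<pi> x"
    using free_presentation_central_extension[OF pres] by (auto simp: q_def)
  \<comment> \<open>\<open>R\<close> is a union of cosets because \<open>\<pi>\<close> factors
    through \<open>q\<close>. This lets \<open>q\<close> commute with the intersection
    below.\<close>
  have "x \<in> R" if "x \<in> carrier F" "q x \<in> q ` R" for x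
    using that p by (auto simp: se(5) kernel_def) metis
  moreover have "M_bracket F (carrier F) (carrier F) \<subseteq> carrier F"
    by (intro subgroup.subset F.M_bracket_subgroup F.conj_invariant_carrier)
  ultimately have "q ` (M_bracket F (carrier F) (carrier F) \<inter> R)
      = q ` M_bracket F (carrier F) (carrier F) \<inter> q ` R"
    by auto
  then show "presentation_multiplier F R
      = Q\<lparr>carrier := M_bracket Q (carrier Q) (carrier Q) \<inter> q ` R\<rparr>"
    unfolding presentation_multiplier_def mla_quotient_restrict Q'
    by (simp add: Q_def q_def)
qed

theorem corollary4p11:
  fixes F :: "'f mult_lie" and G :: "'g mult_lie" and R :: "'f set" and \<pi> :: "'f \<Rightarrow> 'g"
  assumes "free_presentation R F \<pi> G"
    and "mla_perfect G"
  shows "is_cover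
    (mla_quotient (F\<lparr>carrier := M_bracket F (carrier F) (carrier F)\<rparr>) (M_bracket F R (carrier F))) G"
proof -
  have G: "mult_lie_algebra G"
    using assms(1) by (auto simp: free_presentation_def short_exact_def)
  \<comment> \<open>The second presentation is the one by which \<open>schur_multiplier\<close> is
    computed; the given one is compared with it.\<close>
  define F0 where "F0 = Free_mla (carrier G)"
  define R0 where "R0 = kernel F0 G (canonical_projection G)"
  have pres0: "free_presentation R0 F0 (canonical_projection G) G"
    unfolding R0_def F0_def by (rule free_presentation_canonical[OF G])
  define Q where "Q = mla_quotient F (M_bracket F R (carrier F))"
  define q where "q = (\<lambda>x. M_bracket F R (carrier F) #>\<^bsub>F\<^esub> x)"
  define Q0 where "Q0 = mla_quotient F0 (M_bracket F0 R0 (carrier F0))"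
  define q0 where "q0 = (\<lambda>x. M_bracket F0 R0 (carrier F0) #>\<^bsub>F0\<^esub> x)"
  have carr: "carrier Q = q ` carrier F" "carrier Q0 = q0 ` carrier F0"
    by (auto simp: Q_def q_def Q0_def q0_def RCOSETS_def)
  obtain p where p: "central_extension (q ` R) Q p G" "\<And>x. x \<in> carrier F \<Longrightarrow> p (q x) = \<pi> x"
    using free_presentation_central_extension[OF assms(1)] by (auto simp: Q_def q_def)
  obtain p0 where p0: "central_extension (q0 ` R0) Q0 p0 G"
    "\<And>x. x \<in> carrier F0 \<Longrightarrow> p0 (q0 x) = canonical_projection G x"
    using free_presentation_central_extension[OF pres0] by (auto simp: Q0_def q0_def)
  \<comment> \<open>Each central extension comes from a free presentation and so maps over
    \<open>G\<close> to the other; this gives \<open>f\<close> and \<open>g\<close>.\<close>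
  have "\<exists>f\<in>mla_hom Q Q0. \<forall>x\<in>carrier F. p0 (f (q x)) = \<pi> x"
    unfolding Q_def q_def by (rule free_presentation_lift_central[OF assms(1) p0(1)])
  then obtain f where f: "f \<in> mla_hom Q Q0" "\<And>x. x \<in> carrier Q \<Longrightarrow> p0 (f x) = p x"
    unfolding carr using p(2) by (metis imageE)
  have "\<exists>g\<in>mla_hom Q0 Q. \<forall>x\<in>carrier F0. p (g (q0 x)) = canonical_projection G x"
    unfolding Q0_def q0_def by (rule free_presentation_lift_central[OF pres0 p(1)])
  then obtain g where g: "g \<in> mla_hom Q0 Q" "\<And>x. x \<in> carrier Q0 \<Longrightarrow> p (g x) = p0 x"
    unfolding carr using p0(2) by (metis imageE)
  define Q' where "Q' = M_bracket Q (carrier Q) (carrier Q)"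
  have "schur_multiplier G
      = Q0\<lparr>carrier := M_bracket Q0 (carrier Q0) (carrier Q0) \<inter> q0 ` R0\<rparr>"
    using presentation_multiplier_eq(1)[OF pres0]
    by (simp add: schur_multiplier_def F0_def[symmetric] R0_def[symmetric] Q0_def q0_def)
  then have "mla_isomorphic (Q\<lparr>carrier := Q' \<inter> q ` R\<rparr>) (schur_multiplier G)"
    using mla_isomorphic_M_bracket_kernel[OF p(1) p0(1) f g] by (simp add: Q'_def)
  then have "stem_cover (Q' \<inter> q ` R) (Q\<lparr>carrier := Q'\<rparr>) p G"
    using stem_extension_M_bracket[OF p(1) assms(2)] by (simp add: stem_cover_def Q'_def)
  \<comment> \<open>The algebra of the claim is equal, as a record, to the bracket of
    \<open>Q\<close>, so no transport along an isomorphism is needed.\<close>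
  moreover have "mla_quotient (F\<lparr>carrier := M_bracket F (carrier F) (carrier F)\<rparr>)
      (M_bracket F R (carrier F)) = Q\<lparr>carrier := Q'\<rparr>"
    using presentation_multiplier_eq(2)[OF assms(1)]
    by (simp add: mla_quotient_restrict Q'_def Q_def)
  ultimately show ?thesis by (auto simp: is_cover_def)
qed

end
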